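(* Let $H_0\in C^2(\mathbb{R}^d)$ be convex, coercive ($H_0(p)\to+\infty$ as $|p|\to\infty$) and superlinear ($H_0(p)/|p|\to+\infty$ as $|p|\to\infty$), let $V:\mathbb{T}^d\to\mathbb{R}$ be Lipschitz continuous and semiconcave, let $g:\mathbb{T}^d\to\mathbb{R}$ be Lipschitz continuous and semiconcave, and set $H(x,p)=H_0(p)-V(x)$. Let $u$ be the viscosity solution of $$-\partial_tu+H(x,Du)=0\ \text{ in }\mathbb{T}^d\times(0,T),\qquad u(\cdot,T)=g\ \text{ on }\mathbb{T}^d .$$ Then for every $p\in[1,+\infty]$ there exists a constant $C>0$, independent of $\Delta t$, such that for every $\Delta t>0$ with $N=T/\Delta t$ a positive integer, the solution $\{u_n^{\Delta t}\}_{n=0}^N$ of the time-discrete semi-Lagrangian scheme $$u^{\Delta t}_n(x)=\inf_{\alpha\in\mathbb{R}^d}\big\{u^{\Delta t}_{n+1}(x-\alpha\Delta t)+\Delta t\,(L(\alpha)+V(x))\big\},\quad x\in\mathbb{T}^d,\ n=0,\dots,N-1,\qquad u_N^{\Delta t}=g,$$ where $L$ is the Legendre transform of $H_0$, satisfies $$\sup_{n=0,\dots,N}\big\|u_n^{\Delta t}(\cdot)-u(\cdot,n\Delta t)\big\|_{L^p(\mathbb{T}^d)}\le C\,\Delta t^{\frac12+\frac1{2p}},$$ with the convention $1/p=0$ for $p=+\infty$.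
   Context: Fix $d\ge1$ and $T>0$. $\mathbb{T}^d=\mathbb{R}^d/\mathbb{Z}^d$ is the flat torus; functions on $\mathbb{T}^d$ are identified with $\mathbb{Z}^d$-periodic functions on $\mathbb{R}^d$. A function $u$ is semiconcave if there is $C_{conc}>0$ such that for all $x_1,x_2$ and $\lambda\in(0,1)$: $u(\lambda x_1+(1-\lambda)x_2)\ge\lambda u(x_1)+(1-\lambda)u(x_2)-\lambda(1-\lambda)C_{conc}|x_1-x_2|^2$. The Legendre transform is $L(\alpha)=\sup_{p\in\mathbb{R}^d}\{\alpha\cdot p-H_0(p)\}$. The viscosity solution of the backward problem is the function $u$ such that $v(x,s)=u(x,T-s)$ is the viscosity solution of $\partial_sv+H(x,Dv)=0$, $v(\cdot,0)=g$; equivalently it is the value function $u(x,t)=\inf_{\alpha\in L^2([t,T];\mathbb{R}^d)}\big\{\int_t^T[L(\alpha(s))+V(X(s))]\,ds+g(X(T))\big\}$ where $\dot X(s)=-\alpha(s)$ on $(t,T)$, $X(t)=x$. *)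

theory Defs
  imports "HOL-Analysis.Analysis" "HOL-Probability.Essential_Supremum"
begin

(* Functions on the flat torus R^d / Z^d are represented by Z^d-periodic functions on R^d,
   with R^d = real^'n and d = CARD('n). *)

definition torus_periodic :: "(real^'n \<Rightarrow> 'b) \<Rightarrow> bool" where
  "torus_periodic f \<longleftrightarrow> (\<forall>x k. (\<forall>i. k $ i \<in> \<int>) \<longrightarrow> f (x + k) = f x)"

definition torus_measure :: "(real^'n) measure" where
  "torus_measure = restrict_space lborel (cbox 0 1)"

(* L^p norm over the unit cell, p in [1, \<infinity>].  As for esssup, the value is
   \<infinity> for functions that are not measurable. *)
definition torus_Lp_norm :: "ennreal \<Rightarrow> (real^'n \<Rightarrow> real) \<Rightarrow> ennreal" where
  "torus_Lp_norm p f =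
    (if p = \<infinity> then esssup torus_measure (\<lambda>x. ennreal \<bar>f x\<bar>)
     else if f \<in> borel_measurable torus_measure then
       (let I = (\<integral>\<^sup>+x. ennreal (\<bar>f x\<bar> powr enn2real p) \<partial>torus_measure)
        in if I = \<infinity> then \<infinity> else ennreal (enn2real I powr (1 / enn2real p)))
     else \<infinity>)"

definition semiconcave :: "(real^'n \<Rightarrow> real) \<Rightarrow> bool" where
  "semiconcave f \<longleftrightarrow> (\<exists>C>0. \<forall>x\<^sub>1 x\<^sub>2. \<forall>l\<in>{0<..<1}.
     f (l *\<^sub>R x\<^sub>1 + (1 - l) *\<^sub>R x\<^sub>2)
       \<ge> l * f x\<^sub>1 + (1 - l) * f x\<^sub>2 - l * (1 - l) * C * (norm (x\<^sub>1 - x\<^sub>2))\<^sup>2)"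

(* G is the gradient and D the Hessian matrix of f. *)
definition C2_function :: "(real^'n \<Rightarrow> real) \<Rightarrow> bool" where
  "C2_function f \<longleftrightarrow> (\<exists>(G :: real^'n \<Rightarrow> real^'n) (D :: real^'n \<Rightarrow> real^'n^'n).
     (\<forall>p. (f has_derivative (\<lambda>h. G p \<bullet> h)) (at p)) \<and>
     (\<forall>p. (G has_derivative (\<lambda>h. D p *v h)) (at p)) \<and>
     continuous_on UNIV D)"

(* The supremum of reals is a genuine one (the set is bounded above) whenever H0 is
   continuous and superlinear. *)
definition legendre :: "(real^'n \<Rightarrow> real) \<Rightarrow> real^'n \<Rightarrow> real" where
  "legendre H0 \<alpha> = (SUP p. \<alpha> \<bullet> p - H0 p)"

(* \<phi> is C^1 on R^d x (0,T), with space gradient q and time derivative r. *)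
definition C1_test_function ::
  "real \<Rightarrow> ((real^'n) \<times> real \<Rightarrow> real) \<Rightarrow> ((real^'n) \<times> real \<Rightarrow> real^'n) \<Rightarrow> ((real^'n) \<times> real \<Rightarrow> real) \<Rightarrow> bool"
where
  "C1_test_function T \<phi> q r \<longleftrightarrow>
     (\<forall>z \<in> UNIV \<times> {0<..<T}. (\<phi> has_derivative (\<lambda>(h, k). q z \<bullet> h + r z * k)) (at z)) \<and>
     continuous_on (UNIV \<times> {0<..<T}) q \<and> continuous_on (UNIV \<times> {0<..<T}) r"

(* Viscosity sub- and supersolutions of  v_s + H(x, Dv) = 0  on R^d x (0,T).  Test functions
   need not be periodic: only their values near the point of contact matter, and there the
   torus and R^d are the same. *)
definition viscosity_subsolution ::
  "(real^'n \<Rightarrow> real^'n \<Rightarrow> real) \<Rightarrow> real \<Rightarrow> (real^'n \<Rightarrow> real \<Rightarrow> real) \<Rightarrow> bool" where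
  "viscosity_subsolution H T v \<longleftrightarrow>
     (\<forall>\<phi> q r. C1_test_function T \<phi> q r \<longrightarrow>
       (\<forall>x. \<forall>s\<in>{0<..<T}.
          (\<forall>\<^sub>F z in nhds (x, s). v (fst z) (snd z) - \<phi> z \<le> v x s - \<phi> (x, s)) \<longrightarrow>
          r (x, s) + H x (q (x, s)) \<le> 0))"

definition viscosity_supersolution ::
  "(real^'n \<Rightarrow> real^'n \<Rightarrow> real) \<Rightarrow> real \<Rightarrow> (real^'n \<Rightarrow> real \<Rightarrow> real) \<Rightarrow> bool" where
  "viscosity_supersolution H T v \<longleftrightarrow>
     (\<forall>\<phi> q r. C1_test_function T \<phi> q r \<longrightarrow>
       (\<forall>x. \<forall>s\<in>{0<..<T}.
          (\<forall>\<^sub>F z in nhds (x, s). v (fst z) (snd z) - \<phi> z \<ge> v x s - \<phi> (x, s)) \<longrightarrow>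
          r (x, s) + H x (q (x, s)) \<ge> 0))"

definition viscosity_solution_forward ::
  "(real^'n \<Rightarrow> real^'n \<Rightarrow> real) \<Rightarrow> real \<Rightarrow> (real^'n \<Rightarrow> real) \<Rightarrow> (real^'n \<Rightarrow> real \<Rightarrow> real) \<Rightarrow> bool" where
  "viscosity_solution_forward H T g v \<longleftrightarrow>
     (\<forall>s\<in>{0..T}. torus_periodic (\<lambda>x. v x s)) \<and>
     continuous_on (UNIV \<times> {0..T}) (\<lambda>(x, s). v x s) \<and>
     viscosity_subsolution H T v \<and> viscosity_supersolution H T v \<and>
     (\<forall>x. v x 0 = g x)"

(* -u_t + H(x, Du) = 0 with u(., T) = g; the sign convention is fixed by time reversal. *)
definition viscosity_solution_backward ::
  "(real^'n \<Rightarrow> real^'n \<Rightarrow> real) \<Rightarrow> real \<Rightarrow> (real^'n \<Rightarrow> real) \<Rightarrow> (real^'n \<Rightarrow> real \<Rightarrow> real) \<Rightarrow> bool" where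
  "viscosity_solution_backward H T g u \<longleftrightarrow> viscosity_solution_forward H T g (\<lambda>x s. u x (T - s))"

(* The periodic extensions of the u_n solve the same recursion with x ranging over R^d. For g
   continuous and periodic, V bounded and L bounded below, the set under the infimum is bounded
   below, so that the infimum of reals is a genuine one. *)
definition semi_lagrangian_solution ::
  "(real^'n \<Rightarrow> real) \<Rightarrow> (real^'n \<Rightarrow> real) \<Rightarrow> (real^'n \<Rightarrow> real) \<Rightarrow> real \<Rightarrow> nat \<Rightarrow>
   (nat \<Rightarrow> real^'n \<Rightarrow> real) \<Rightarrow> bool" where
  "semi_lagrangian_solution L V g \<Delta>t N w \<longleftrightarrow>
     w N = g \<and>
     (\<forall>n<N. \<forall>x. w n x = (INF \<alpha>. w (Suc n) (x - \<Delta>t *\<^sub>R \<alpha>) + \<Delta>t * (L \<alpha> + V x)))"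

end

theory Submission
  imports Defs
begin

text \<open>
  The scheme is in fact of first order in the sup norm, \<open>|u\<^sub>n - u(\<cdot>, n \<Delta>t)| \<le> C \<Delta>t\<close>.
  The reason is that the running cost \<open>L(\<alpha>) + V(x)\<close> separates control and state. Replacing
  the controls on a time interval of length \<open>\<Delta>t\<close> by their mean does not change the end point and
  does not increase the cost of the controls, by convexity of \<open>L\<close>. The cost of the state changes by
  at most the Lipschitz constant of \<open>V\<close> times the distance travelled, that is by
  \<open>O(\<Delta>t)\<close> per unit of time: near-optimal controls are bounded, since \<open>L\<close> is superlinear and
  the value functions are Lipschitz.

  This argument is used between two discretisations, with steps \<open>\<Delta>t\<close> and \<open>\<Delta>t / m\<close>, and
  gives a bound that is uniform in \<open>m\<close> (\<open>Z_refinement\<close>). It remains to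
  know that for \<open>m \<rightarrow> \<infinity>\<close> the refined scheme tends to the viscosity solution. This follows
  by doubling the variables, one copy of time being the discrete time of the scheme
  (\<open>doubling_comparison\<close>): at a maximum of the doubled functional
  the scheme satisfies the viscosity inequalities up to \<open>O(\<delta> / \<epsilon>)\<close>, where \<open>\<delta>\<close> is
  the step and \<open>\<epsilon>\<close> the penalisation parameter, by the Fenchel inequality in one direction
  and by its equality case in the other.

  On the unit cell, which has measure one, the sup norm dominates every \<open>L\<^sup>p\<close> norm, and
  \<open>\<Delta>t\<close> is bounded by a multiple of any lower power of itself because \<open>\<Delta>t \<le> T\<close>. The exponent
  \<open>1/2 + 1/(2p)\<close> lies between \<open>1/2\<close> and \<open>1\<close>.
\<close>

section \<open>The semi-Lagrangian scheme\<close>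


definition sl_step :: "('a::euclidean_space \<Rightarrow> real) \<Rightarrow> ('a \<Rightarrow> real) \<Rightarrow> real \<Rightarrow> ('a \<Rightarrow> real) \<Rightarrow> 'a \<Rightarrow> real" where
  "sl_step L V \<delta> f x = (INF a. f (x - \<delta> *\<^sub>R a) + \<delta> * (L a + V x))"

text \<open>The scheme runs backwards from the terminal time; \<open>k\<close> counts the steps
  already taken, so that it is a forward discrete time.\<close>

definition sl_iter :: "('a::euclidean_space \<Rightarrow> real) \<Rightarrow> ('a \<Rightarrow> real) \<Rightarrow> ('a \<Rightarrow> real) \<Rightarrow> real \<Rightarrow> nat \<Rightarrow> 'a \<Rightarrow> real" where
  "sl_iter L V g \<delta> k = (sl_step L V \<delta> ^^ k) g"

lemma sl_iter_0 [simp]: "sl_iter L V g \<delta> 0 = g"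
  by (simp add: sl_iter_def)

lemma sl_iter_Suc: "sl_iter L V g \<delta> (Suc k) = sl_step L V \<delta> (sl_iter L V g \<delta> k)"
  by (simp add: sl_iter_def)

text \<open>The abbreviation \<open>Z \<delta> k\<close> is the discrete
  value function with \<open>k\<close> steps of length \<open>\<delta>\<close> to go.\<close>

locale sl_scheme =
  fixes L V g :: "'a::euclidean_space \<Rightarrow> real" and KV Kg T :: real
  assumes L_convex: "convex_on UNIV L"
    and L_superlinear: "\<exists>C. \<forall>a. M * norm a - C \<le> L a"
    and V_lipschitz: "KV-lipschitz_on UNIV V"
    and g_lipschitz: "Kg-lipschitz_on UNIV g"
    and T_nonneg: "0 \<le> T"
begin

abbreviation step where "step \<equiv> sl_step L V"
abbreviation Z where "Z \<equiv> sl_iter L V g"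

lemma KV_nonneg: "0 \<le> KV"
  using V_lipschitz by (rule lipschitz_on_nonneg)

lemma V_diff: "\<bar>V x - V y\<bar> \<le> KV * norm (x - y)"
  using lipschitz_onD[OF V_lipschitz, of x y] by (simp add: dist_norm)

text \<open>The infimum of reals is genuine: moving away with control \<open>a\<close> lowers a
  \<open>K\<close>-Lipschitz \<open>f\<close> by at most \<open>\<delta> K |a|\<close>,
  and the superlinear cost \<open>L\<close> pays for that.\<close>

lemma step_bdd_below:
  assumes "K-lipschitz_on UNIV f" "0 \<le> \<delta>"
  shows "bdd_below (range (\<lambda>a. f (x - \<delta> *\<^sub>R a) + \<delta> * (L a + V x)))"
proof -
  obtain C where C: "\<And>a. K * norm a - C \<le> L a" using L_superlinear by blast
  have "f x - \<delta> * C + \<delta> * V x \<le> f (x - \<delta> *\<^sub>R a) + \<delta> * (L a + V x)" for a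
  proof -
    have "\<bar>f (x - \<delta> *\<^sub>R a) - f x\<bar> \<le> K * (\<delta> * norm a)"
      using lipschitz_onD[OF assms(1), of "x - \<delta> *\<^sub>R a" x] assms(2) by (simp add: dist_norm)
    moreover have "\<delta> * (K * norm a - C) \<le> \<delta> * L a"
      using C assms(2) by (intro mult_left_mono)
    ultimately show ?thesis by (simp add: algebra_simps)
  qed
  then show ?thesis by (auto intro!: bdd_belowI)
qed

lemma step_le:
  assumes "K-lipschitz_on UNIV f" "0 \<le> \<delta>"
  shows "step \<delta> f x \<le> f (x - \<delta> *\<^sub>R a) + \<delta> * (L a + V x)"
  unfolding sl_step_def by (rule cINF_lower[OF step_bdd_below[OF assms]]) simp

lemma step_greatest:
  assumes "\<And>a. c \<le> f (x - \<delta> *\<^sub>R a) + \<delta> * (L a + V x)"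
  shows "c \<le> step \<delta> f x"
  unfolding sl_step_def using assms by (intro cINF_greatest) auto

lemma step_lipschitz:
  assumes f: "K-lipschitz_on UNIV f" and \<delta>: "0 \<le> \<delta>"
  shows "(K + \<delta> * KV)-lipschitz_on UNIV (step \<delta> f)"
proof -
  have le: "step \<delta> f x \<le> step \<delta> f y + (K + \<delta> * KV) * norm (x - y)" for x y
  proof -
    have "step \<delta> f x - (K + \<delta> * KV) * norm (x - y) \<le> f (y - \<delta> *\<^sub>R a) + \<delta> * (L a + V y)" for a
    proof -
      have "\<bar>f (x - \<delta> *\<^sub>R a) - f (y - \<delta> *\<^sub>R a)\<bar> \<le> K * norm (x - y)"
        using lipschitz_onD[OF f, of "x - \<delta> *\<^sub>R a" "y - \<delta> *\<^sub>R a"] by (simp add: dist_norm)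
      moreover have "\<delta> * (V x - V y) \<le> \<delta> * (KV * norm (x - y))"
        using V_diff[of x y] \<delta> by (intro mult_left_mono) auto
      ultimately show ?thesis using step_le[OF f \<delta>, of x a] by (simp add: algebra_simps)
    qed
    from step_greatest[OF this] show ?thesis by simp
  qed
  show ?thesis
  proof (rule lipschitz_onI)
    show "0 \<le> K + \<delta> * KV" using lipschitz_on_nonneg[OF f] KV_nonneg \<delta> by simp
    fix x y show "dist (step \<delta> f x) (step \<delta> f y) \<le> (K + \<delta> * KV) * dist x y"
      using le[of x y] le[of y x] by (simp add: dist_norm norm_minus_commute abs_le_iff)
  qed
qed

lemma Z_lipschitz_growing:
  assumes "0 \<le> \<delta>"
  shows "(Kg + real k * \<delta> * KV)-lipschitz_on UNIV (Z \<delta> k)"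
proof (induction k)
  case 0 then show ?case using g_lipschitz by simp
next
  case (Suc k)
  from step_lipschitz[OF this assms] show ?case by (simp add: sl_iter_Suc algebra_simps)
qed

text \<open>Each step adds \<open>\<delta> KV\<close> to the Lipschitz constant; \<open>K\<close> is the total over
  a time \<open>T\<close> and hence serves for all step sizes at once.\<close>

definition K where "K = Kg + T * KV"

lemma K_nonneg: "0 \<le> K"
  unfolding K_def using T_nonneg KV_nonneg lipschitz_on_nonneg[OF g_lipschitz] by simp

lemma Z_lipschitz:
  assumes "0 \<le> \<delta>" "real k * \<delta> \<le> T"
  shows "K-lipschitz_on UNIV (Z \<delta> k)"
  using Z_lipschitz_growing[OF assms(1), of k] 
  by (rule lipschitz_on_mono) (use assms(2) KV_nonneg in \<open>auto simp: K_def mult_right_mono\<close>)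

lemma Z_diff:
  assumes "0 \<le> \<delta>" "real k * \<delta> \<le> T"
  shows "\<bar>Z \<delta> k x - Z \<delta> k y\<bar> \<le> K * norm (x - y)"
  using lipschitz_onD[OF Z_lipschitz[OF assms], of x y] by (simp add: dist_norm)

lemma Z_Suc_le:
  assumes "0 \<le> \<delta>" "real k * \<delta> \<le> T"
  shows "Z \<delta> (Suc k) x \<le> Z \<delta> k (x - \<delta> *\<^sub>R a) + \<delta> * (L a + V x)"
  unfolding sl_iter_Suc by (rule step_le[OF Z_lipschitz[OF assms] assms(1)])

text \<open>For \<open>|a| > R\<close> the superlinear cost exceeds everything that the \<open>K\<close>-Lipschitz value
  function can gain, so the control \<open>0\<close> is at least as good. The radius does not depend on the
  step size, which makes all later errors per step of second order, uniformly.\<close>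

lemma Z_bounded_controls:
  obtains R where "0 \<le> R"
    "\<And>\<delta> k x c. 0 < \<delta> \<Longrightarrow> real k * \<delta> \<le> T \<Longrightarrow> Z \<delta> (Suc k) x < c \<Longrightarrow>
       \<exists>a. norm a \<le> R \<and> Z \<delta> k (x - \<delta> *\<^sub>R a) + \<delta> * (L a + V x) < c"
proof -
  obtain C where C: "\<And>a. (K + 1) * norm a - C \<le> L a" using L_superlinear by blast
  define R where "R = max 0 (C + L 0)"
  show thesis
  proof (rule that[of R])
    show "0 \<le> R" by (simp add: R_def)
    fix \<delta> k x c
    assume \<delta>: "0 < \<delta>" and k: "real k * \<delta> \<le> T" and c: "Z \<delta> (Suc k) x < c"
    obtain a where a: "Z \<delta> k (x - \<delta> *\<^sub>R a) + \<delta> * (L a + V x) < c"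
      using c step_bdd_below[OF Z_lipschitz[OF _ k], of \<delta> x] \<delta>
      by (auto simp: sl_iter_Suc sl_step_def cINF_less_iff)
    show "\<exists>a. norm a \<le> R \<and> Z \<delta> k (x - \<delta> *\<^sub>R a) + \<delta> * (L a + V x) < c"
    proof (cases "norm a \<le> R")
      case True with a show ?thesis by blast
    next
      case False
      then have "L 0 \<le> norm a - C" by (simp add: R_def)
      then have "L 0 + K * norm a \<le> L a" using C[of a] by (simp add: algebra_simps)
      then have "\<delta> * (L 0 + K * norm a) \<le> \<delta> * L a" using \<delta> by (intro mult_left_mono) auto
      moreover have "\<bar>Z \<delta> k (x - \<delta> *\<^sub>R a) - Z \<delta> k x\<bar> \<le> K * (\<delta> * norm a)"
        using Z_diff[of \<delta> k "x - \<delta> *\<^sub>R a" x] \<delta> k by simp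
      ultimately have "Z \<delta> k x + \<delta> * (L 0 + V x) < c" using a by (simp add: algebra_simps)
      then show ?thesis using \<open>0 \<le> R\<close> by (intro exI[of _ 0]) simp
    qed
  qed
qed

text \<open>Upper bound: stand still. Lower bound: by the argument of
  \<open>step_bdd_below\<close>, one step gains at most a multiple of \<open>\<delta>\<close>.\<close>

lemma Z_time_lipschitz:
  assumes V: "\<And>x. \<bar>V x\<bar> \<le> B"
  obtains C where "0 \<le> C"
    "\<And>\<delta> k x. 0 \<le> \<delta> \<Longrightarrow> real (Suc k) * \<delta> \<le> T \<Longrightarrow> \<bar>Z \<delta> (Suc k) x - Z \<delta> k x\<bar> \<le> C * \<delta>"
proof -
  obtain C where C: "\<And>a. K * norm a - C \<le> L a" using L_superlinear by blast
  show thesis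
  proof (rule that[of "\<bar>C\<bar> + \<bar>L 0\<bar> + B"])
    show "0 \<le> \<bar>C\<bar> + \<bar>L 0\<bar> + B" using V[of 0] by linarith
    fix \<delta> k x
    assume \<delta>: "0 \<le> \<delta>" and k': "real (Suc k) * \<delta> \<le> T"
    have k: "real k * \<delta> \<le> T" using \<delta> k' by (simp add: algebra_simps)
    have "Z \<delta> (Suc k) x \<le> Z \<delta> k x + \<delta> * (L 0 + V x)"
      using Z_Suc_le[OF \<delta> k, of x 0] by simp
    moreover have "\<delta> * (L 0 + V x) \<le> \<delta> * (\<bar>C\<bar> + \<bar>L 0\<bar> + B)"
      using V[of x] \<delta> by (intro mult_left_mono) auto
    moreover have "Z \<delta> k x - \<delta> * (\<bar>C\<bar> + \<bar>L 0\<bar> + B) \<le> Z \<delta> (Suc k) x"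
      unfolding sl_iter_Suc
    proof (rule step_greatest)
      fix a
      have "\<bar>Z \<delta> k (x - \<delta> *\<^sub>R a) - Z \<delta> k x\<bar> \<le> K * (\<delta> * norm a)"
        using Z_diff[OF \<delta> k, of "x - \<delta> *\<^sub>R a" x] \<delta> by simp
      moreover have "\<delta> * (K * norm a - \<bar>C\<bar> - \<bar>L 0\<bar> - B) \<le> \<delta> * (L a + V x)"
        using C[of a] V[of x] \<delta> by (intro mult_left_mono) auto
      ultimately show "Z \<delta> k x - \<delta> * (\<bar>C\<bar> + \<bar>L 0\<bar> + B) \<le> Z \<delta> k (x - \<delta> *\<^sub>R a) + \<delta> * (L a + V x)"
        by (simp add: algebra_simps)
    qed
    ultimately show "\<bar>Z \<delta> (Suc k) x - Z \<delta> k x\<bar> \<le> (\<bar>C\<bar> + \<bar>L 0\<bar> + B) * \<delta>"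
      by (simp add: algebra_simps)
  qed
qed

text \<open>Holding one control \<open>a\<close> for \<open>m\<close> small steps costs as much as one
  large step with \<open>a\<close>, apart from the variation of \<open>V\<close> along the segment, which has
  length \<open>m \<delta> |a|\<close> and is run through in time \<open>m \<delta>\<close>.\<close>

lemma Z_constant_control:
  assumes \<delta>: "0 \<le> \<delta>" and "real (j + m) * \<delta> \<le> T"
  shows "Z \<delta> (j + m) x \<le> Z \<delta> j (x - (real m * \<delta>) *\<^sub>R a) + real m * \<delta> * (L a + V x)
            + KV * norm a * (real m * \<delta>)\<^sup>2"
  using assms(2)
proof (induction m arbitrary: x)
  case 0 then show ?case by simp
next
  case (Suc m)
  have k: "real (j + m) * \<delta> \<le> T" using Suc.prems \<delta> by (simp add: algebra_simps)
  let ?y = "x - \<delta> *\<^sub>R a" and ?h = "real m * \<delta>"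
  have h: "0 \<le> ?h" using \<delta> by simp
  have "V ?y \<le> V x + KV * (\<delta> * norm a)" using V_diff[of ?y x] \<delta> by (simp add: abs_le_iff)
  then have "?h * V ?y \<le> ?h * (V x + KV * (\<delta> * norm a))" using h by (rule mult_left_mono)
  moreover have "Z \<delta> (j + Suc m) x \<le> Z \<delta> (j + m) ?y + \<delta> * (L a + V x)"
    using Z_Suc_le[OF \<delta> k, of x a] by simp
  moreover have "Z \<delta> (j + m) ?y \<le> Z \<delta> j (?y - ?h *\<^sub>R a) + ?h * (L a + V ?y) + KV * norm a * ?h\<^sup>2"
    by (rule Suc.IH[OF k])
  moreover have "?y - ?h *\<^sub>R a = x - (real (Suc m) * \<delta>) *\<^sub>R a" by (simp add: algebra_simps)
  moreover have "KV * norm a * ?h\<^sup>2 + ?h * (KV * (\<delta> * norm a)) \<le> KV * norm a * (real (Suc m) * \<delta>)\<^sup>2"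
  proof -
    have "?h\<^sup>2 + ?h * \<delta> \<le> (real (Suc m) * \<delta>)\<^sup>2"
      using h \<delta> by (simp add: power2_eq_square algebra_simps)
    then have "KV * norm a * (?h\<^sup>2 + ?h * \<delta>) \<le> KV * norm a * (real (Suc m) * \<delta>)\<^sup>2"
      using KV_nonneg by (intro mult_left_mono) auto
    then show ?thesis by (simp add: algebra_simps)
  qed
  ultimately show ?case by (simp add: algebra_simps)
qed

text \<open>Conversely, \<open>m\<close> small steps can be replaced by a single one with the mean control
  \<open>b\<close>: the end point is the same, the cost \<open>L\<close> does not increase by Jensen's inequality,
  and freezing \<open>V\<close> at the starting point costs \<open>KV R (m \<delta>)\<^sup>2\<close>. The induction on
  \<open>m\<close> averages two controls at a time, with weights \<open>1/(m+1)\<close> and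
  \<open>m/(m+1)\<close>.\<close>

lemma Z_averaged_control:
  assumes R: "\<And>\<delta> k x c. 0 < \<delta> \<Longrightarrow> real k * \<delta> \<le> T \<Longrightarrow> Z \<delta> (Suc k) x < c \<Longrightarrow>
       \<exists>a. norm a \<le> R \<and> Z \<delta> k (x - \<delta> *\<^sub>R a) + \<delta> * (L a + V x) < c"
    and R0: "0 \<le> R" and \<delta>: "0 < \<delta>"
    and "real (j + m) * \<delta> \<le> T" "Z \<delta> (j + m) x < c"
  shows "\<exists>b. norm b \<le> R \<and>
     Z \<delta> j (x - (real m * \<delta>) *\<^sub>R b) + real m * \<delta> * (L b + V x) - KV * R * (real m * \<delta>)\<^sup>2 < c"
  using assms(4,5)
proof (induction m arbitrary: x c)
  case 0 then show ?case using R0 by (intro exI[of _ 0]) simp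
next
  case (Suc m)
  have k: "real (j + m) * \<delta> \<le> T" using Suc.prems \<delta> by (simp add: algebra_simps)
  let ?h = "real m * \<delta>"
  have h: "0 \<le> ?h" using \<delta> by simp
  obtain a where a: "norm a \<le> R" "Z \<delta> (j + m) (x - \<delta> *\<^sub>R a) + \<delta> * (L a + V x) < c"
    using R[OF \<delta> k, of x c] Suc.prems by auto
  let ?y = "x - \<delta> *\<^sub>R a"
  have "Z \<delta> (j + m) ?y < c - \<delta> * (L a + V x)" using a by simp
  from Suc.IH[OF k this] obtain b where b: "norm b \<le> R"
    "Z \<delta> j (?y - ?h *\<^sub>R b) + ?h * (L b + V ?y) - KV * R * ?h\<^sup>2 < c - \<delta> * (L a + V x)"
    by blast
  \<comment> \<open>the mean of the first control and of the mean of the other \<open>m\<close>\<close>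
  define t where "t = 1 / real (Suc m)"
  define d where "d = t *\<^sub>R a + (1 - t) *\<^sub>R b"
  have t: "0 \<le> t" "t \<le> 1" by (auto simp: t_def)
  have tS: "real (Suc m) * t = 1" "real (Suc m) * (1 - t) = real m"
    by (auto simp: t_def field_simps)
  have hd: "(real (Suc m) * \<delta>) *\<^sub>R d = \<delta> *\<^sub>R a + ?h *\<^sub>R b"
  proof -
    have "(real (Suc m) * \<delta>) *\<^sub>R d = (\<delta> * (real (Suc m) * t)) *\<^sub>R a + (\<delta> * (real (Suc m) * (1 - t))) *\<^sub>R b"
      unfolding d_def by (simp add: scaleR_add_right ac_simps del: of_nat_Suc)
    then show ?thesis unfolding tS by (simp add: mult.commute)
  qed
  have "norm d \<le> t * R + (1 - t) * R"
    unfolding d_def using a(1) b(1) t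
    by (intro norm_triangle_le add_mono) (auto simp: mult_left_mono)
  then have "norm d \<le> R" by (simp add: algebra_simps)
  moreover have "real (Suc m) * \<delta> * L d \<le> \<delta> * L a + ?h * L b"
  proof -
    have "L d \<le> t * L a + (1 - t) * L b"
      unfolding d_def using convex_onD[OF L_convex, of "1 - t" a b] t by simp
    then have "real (Suc m) * \<delta> * L d \<le> real (Suc m) * \<delta> * (t * L a + (1 - t) * L b)"
      using \<delta> by (intro mult_left_mono) auto
    also have "\<dots> = (real (Suc m) * t) * \<delta> * L a + (real (Suc m) * (1 - t)) * \<delta> * L b"
      by (simp add: algebra_simps del: of_nat_Suc)
    also have "\<dots> = \<delta> * L a + ?h * L b" unfolding tS by simp
    finally show ?thesis .
  qed
  moreover have "?h * (V x - KV * (\<delta> * R)) \<le> ?h * V ?y"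
  proof -
    have "V x - V ?y \<le> KV * (\<delta> * norm a)" using V_diff[of x ?y] \<delta> by (simp add: abs_le_iff)
    also have "\<dots> \<le> KV * (\<delta> * R)" using KV_nonneg \<delta> a(1) by (intro mult_left_mono) auto
    finally show ?thesis using h by (intro mult_left_mono) auto
  qed
  moreover have "KV * R * ?h\<^sup>2 + ?h * (KV * (\<delta> * R)) \<le> KV * R * (real (Suc m) * \<delta>)\<^sup>2"
  proof -
    have "?h\<^sup>2 + ?h * \<delta> \<le> (real (Suc m) * \<delta>)\<^sup>2"
      using h \<delta> by (simp add: power2_eq_square algebra_simps)
    then have "KV * R * (?h\<^sup>2 + ?h * \<delta>) \<le> KV * R * (real (Suc m) * \<delta>)\<^sup>2"
      using KV_nonneg R0 by (intro mult_left_mono) auto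
    then show ?thesis by (simp add: algebra_simps)
  qed
  moreover have "Z \<delta> j (?y - ?h *\<^sub>R b) = Z \<delta> j (x - (real (Suc m) * \<delta>) *\<^sub>R d)"
    unfolding hd by (simp add: algebra_simps)
  moreover have "real (Suc m) * \<delta> * V x = \<delta> * V x + ?h * V x" by (simp add: algebra_simps)
  ultimately show ?case using b(2) by (intro exI[of _ d]) (simp add: distrib_left right_diff_distrib del: of_nat_Suc)
qed

text \<open>Subdividing each step into \<open>m\<close> parts changes the result by \<open>O(\<Delta>\<^sup>2)\<close> per step,
  hence by \<open>O(\<Delta>)\<close> in total. The constant is the same for all \<open>m\<close>, so the bound
  persists in the limit of infinite refinement.\<close>

lemma Z_refinement:
  obtains C where "0 \<le> C"
    "\<And>\<Delta> m k x. 0 < \<Delta> \<Longrightarrow> 0 < m \<Longrightarrow> real k * \<Delta> \<le> T \<Longrightarrow>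
        \<bar>Z (\<Delta> / real m) (k * m) x - Z \<Delta> k x\<bar> \<le> C * \<Delta>"
proof -
  obtain R where R0: "0 \<le> R" and R: "\<And>\<delta> k x c. 0 < \<delta> \<Longrightarrow> real k * \<delta> \<le> T \<Longrightarrow> Z \<delta> (Suc k) x < c \<Longrightarrow>
       \<exists>a. norm a \<le> R \<and> Z \<delta> k (x - \<delta> *\<^sub>R a) + \<delta> * (L a + V x) < c"
    using Z_bounded_controls by blast
  have main: "\<bar>Z (\<Delta> / real m) (k * m) x - Z \<Delta> k x\<bar> \<le> real k * (KV * R * \<Delta>\<^sup>2)"
    if \<Delta>: "0 < \<Delta>" and m: "0 < m" and "real k * \<Delta> \<le> T" for \<Delta> m k x
    using that(3)
  proof (induction k arbitrary: x)
    case 0 then show ?case by simp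
  next
    case (Suc k)
    define \<delta> where "\<delta> = \<Delta> / real m"
    have \<delta>: "0 < \<delta>" "real m * \<delta> = \<Delta>" using \<Delta> m by (auto simp: \<delta>_def)
    have k: "real k * \<Delta> \<le> T" using Suc.prems \<Delta> by (simp add: algebra_simps)
    have "real (k * m + m) * \<delta> = real (Suc k) * (real m * \<delta>)" by (simp add: algebra_simps)
    then have km: "real (k * m + m) * \<delta> \<le> T" using Suc.prems unfolding \<delta>(2) by simp
    have IH: "\<bar>Z \<delta> (k * m) y - Z \<Delta> k y\<bar> \<le> real k * (KV * R * \<Delta>\<^sup>2)" for y
      using Suc.IH[OF k] by (simp add: \<delta>_def)
    have "Z \<delta> (k * m + m) x \<le> Z \<Delta> (Suc k) x + real (Suc k) * (KV * R * \<Delta>\<^sup>2)"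
    proof (rule field_le_epsilon)
      fix e :: real assume "0 < e"
      then obtain a where a: "norm a \<le> R"
        "Z \<Delta> k (x - \<Delta> *\<^sub>R a) + \<Delta> * (L a + V x) < Z \<Delta> (Suc k) x + e"
        using R[OF \<Delta> k, of x "Z \<Delta> (Suc k) x + e"] by auto
      have "KV * norm a * \<Delta>\<^sup>2 \<le> KV * R * \<Delta>\<^sup>2"
        using a(1) KV_nonneg by (intro mult_right_mono mult_left_mono) auto
      then show "Z \<delta> (k * m + m) x \<le> Z \<Delta> (Suc k) x + real (Suc k) * (KV * R * \<Delta>\<^sup>2) + e"
        using a(2) IH[of "x - \<Delta> *\<^sub>R a"] Z_constant_control[OF less_imp_le[OF \<delta>(1)] km, of x a, unfolded \<delta>(2)]
        by (simp add: abs_le_iff algebra_simps)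
    qed
    moreover have "Z \<Delta> (Suc k) x \<le> Z \<delta> (k * m + m) x + real (Suc k) * (KV * R * \<Delta>\<^sup>2)"
    proof (rule field_le_epsilon)
      fix e :: real assume "0 < e"
      then obtain b where "norm b \<le> R"
        "Z \<delta> (k * m) (x - \<Delta> *\<^sub>R b) + \<Delta> * (L b + V x) - KV * R * \<Delta>\<^sup>2 < Z \<delta> (k * m + m) x + e"
        using Z_averaged_control[OF R R0 \<delta>(1) km, of x "Z \<delta> (k * m + m) x + e"] unfolding \<delta>(2) by auto
      then show "Z \<Delta> (Suc k) x \<le> Z \<delta> (k * m + m) x + real (Suc k) * (KV * R * \<Delta>\<^sup>2) + e"
        using IH[of "x - \<Delta> *\<^sub>R b"] Z_Suc_le[OF less_imp_le[OF \<Delta>] k, of x b]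
        by (simp add: abs_le_iff algebra_simps)
    qed
    ultimately show ?case by (simp add: abs_le_iff \<delta>_def add.commute algebra_simps)
  qed
  show thesis
  proof (rule that[of "KV * R * T"])
    show "0 \<le> KV * R * T" using KV_nonneg R0 T_nonneg by simp
    fix \<Delta> :: real and m k :: nat and x assume *: "0 < \<Delta>" "0 < m" "real k * \<Delta> \<le> T"
    have "real k * \<Delta> * (KV * R * \<Delta>) \<le> T * (KV * R * \<Delta>)"
      using * KV_nonneg R0 by (intro mult_right_mono) auto
    then show "\<bar>Z (\<Delta> / real m) (k * m) x - Z \<Delta> k x\<bar> \<le> KV * R * T * \<Delta>"
      using main[OF *, of x] by (simp add: power2_eq_square algebra_simps)
  qed
qed

end

section \<open>Penalised maxima and viscosity inequalities\<close>

text \<open>The test function of the doubling argument. The first two terms keep \<open>x\<close> near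
  \<open>y\<close> and \<open>s\<close> near the discrete time \<open>c\<close>; the last one makes the
  viscosity inequality strict by \<open>\<eta>\<close>.\<close>

definition penalty :: "real \<Rightarrow> real \<Rightarrow> real^'n \<Rightarrow> real \<Rightarrow> real^'n \<Rightarrow> real \<Rightarrow> real" where
  "penalty \<epsilon> \<eta> y c x s = (norm (x - y))\<^sup>2 / (2 * \<epsilon>) + (s - c)\<^sup>2 / (2 * \<epsilon>) + \<eta> * s"

text \<open>The sign \<open>\<sigma>\<close> is \<open>1\<close> for subsolutions and \<open>-1\<close> for
  supersolutions.\<close>

lemma penalty_C1:
  fixes y :: "real^'n"
  assumes "\<epsilon> > 0"
  shows "C1_test_function T (\<lambda>z. \<sigma> * penalty \<epsilon> \<eta> y c (fst z) (snd z))
     (\<lambda>z. (\<sigma> / \<epsilon>) *\<^sub>R (fst z - y)) (\<lambda>z. \<sigma> * ((snd z - c) / \<epsilon> + \<eta>))"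
  unfolding C1_test_function_def
proof (intro conjI ballI)
  fix z :: "(real^'n) \<times> real"
  have "((\<lambda>z. \<sigma> * (((fst z - y) \<bullet> (fst z - y)) * (1 / (2 * \<epsilon>)) + (snd z - c) * (snd z - c) * (1 / (2 * \<epsilon>)) + \<eta> * snd z))
     has_derivative (\<lambda>(h, k). (\<sigma> / \<epsilon>) *\<^sub>R (fst z - y) \<bullet> h + \<sigma> * ((snd z - c) / \<epsilon> + \<eta>) * k)) (at z)"
    by (rule derivative_eq_intros refl | simp)+
       (use assms in \<open>auto simp: fun_eq_iff field_simps inner_commute\<close>)
  then show "((\<lambda>z. \<sigma> * penalty \<epsilon> \<eta> y c (fst z) (snd z)) has_derivative
      (\<lambda>(h, k). (\<sigma> / \<epsilon>) *\<^sub>R (fst z - y) \<bullet> h + \<sigma> * ((snd z - c) / \<epsilon> + \<eta>) * k)) (at z)"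
    unfolding penalty_def power2_norm_eq_inner by (simp add: power2_eq_square)
qed (intro continuous_intros; use assms in simp)+

lemma eventually_time_interior:
  fixes x :: "real^'n" and T :: real
  assumes "s \<in> {0<..<T}"
  shows "\<forall>\<^sub>F z in nhds (x, s). snd z \<in> {0..T}"
proof -
  have "open ((UNIV :: (real^'n) set) \<times> {0<..<T})" by (intro open_Times) auto
  then have "\<forall>\<^sub>F z in nhds (x, s). z \<in> UNIV \<times> {0<..<T}"
    using assms by (intro eventually_nhds_in_open) auto
  then show ?thesis by eventually_elim auto
qed

lemma subsolution_at_penalized_max:
  assumes "viscosity_subsolution H T v" "\<epsilon> > 0" and s: "s \<in> {0<..<T}"
    and max: "\<And>x' s'. s' \<in> {0..T} \<Longrightarrow> v x' s' - penalty \<epsilon> \<eta> y c x' s' \<le> v x s - penalty \<epsilon> \<eta> y c x s"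
  shows "(s - c) / \<epsilon> + \<eta> + H x ((1 / \<epsilon>) *\<^sub>R (x - y)) \<le> 0"
proof -
  have "\<forall>\<^sub>F z in nhds (x, s). v (fst z) (snd z) - 1 * penalty \<epsilon> \<eta> y c (fst z) (snd z)
          \<le> v x s - 1 * penalty \<epsilon> \<eta> y c (fst (x, s)) (snd (x, s))"
    using eventually_time_interior[OF s] by eventually_elim (use max in simp)
  with assms(1) penalty_C1[OF assms(2), of T 1 \<eta> y c] s
  have "1 * ((snd (x, s) - c) / \<epsilon> + \<eta>) + H x ((1 / \<epsilon>) *\<^sub>R (fst (x, s) - y)) \<le> 0"
    unfolding viscosity_subsolution_def by blast
  then show ?thesis by simp
qed

lemma supersolution_at_penalized_min:
  assumes "viscosity_supersolution H T v" "\<epsilon> > 0" and s: "s \<in> {0<..<T}"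
    and min: "\<And>x' s'. s' \<in> {0..T} \<Longrightarrow> v x s + penalty \<epsilon> \<eta> y c x s \<le> v x' s' + penalty \<epsilon> \<eta> y c x' s'"
  shows "(s - c) / \<epsilon> + \<eta> \<le> H x ((1 / \<epsilon>) *\<^sub>R (y - x))"
proof -
  have "\<forall>\<^sub>F z in nhds (x, s). v (fst z) (snd z) - (-1) * penalty \<epsilon> \<eta> y c (fst z) (snd z)
          \<ge> v x s - (-1) * penalty \<epsilon> \<eta> y c (fst (x, s)) (snd (x, s))"
    using eventually_time_interior[OF s] by eventually_elim (use min in simp)
  with assms(1) penalty_C1[OF assms(2), of T "-1" \<eta> y c] s
  have "(-1) * ((snd (x, s) - c) / \<epsilon> + \<eta>) + H x ((-1 / \<epsilon>) *\<^sub>R (fst (x, s) - y)) \<ge> 0"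
    unfolding viscosity_supersolution_def by blast
  moreover have "(-1 / \<epsilon>) *\<^sub>R (x - y) = (1 / \<epsilon>) *\<^sub>R (y - x)" by (simp add: scaleR_diff_right)
  ultimately show ?thesis by simp
qed

lemma torus_representative:
  fixes x :: "real^'n"
  obtains m :: "real^'n" where "\<And>i. m $ i \<in> \<int>" "x + m \<in> cbox 0 1"
proof (rule that[of "\<chi> i. - of_int \<lfloor>x $ i\<rfloor>"])
  have "x $ i - of_int \<lfloor>x $ i\<rfloor> \<in> {0..1}" for i
    using frac_ge_0[of "x $ i"] frac_lt_1[of "x $ i"] unfolding frac_def
    by (simp add: less_imp_le)
  then show "x + (\<chi> i. - of_int \<lfloor>x $ i\<rfloor>) \<in> cbox 0 1"
    by (simp add: mem_box_cart)
qed simp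

lemma torus_periodicD:
  assumes "torus_periodic f" "\<And>i. m $ i \<in> \<int>"
  shows "f (x + m) = f x"
  using assms by (auto simp: torus_periodic_def)

lemma periodic_continuous_bounded:
  fixes F :: "real^'n \<Rightarrow> real \<Rightarrow> real"
  assumes per: "\<And>s. s \<in> {0..T} \<Longrightarrow> torus_periodic (\<lambda>x. F x s)"
    and cont: "continuous_on (UNIV \<times> {0..T}) (\<lambda>(x, s). F x s)"
  obtains B where "0 \<le> B" "\<And>x s. s \<in> {0..T} \<Longrightarrow> \<bar>F x s\<bar> \<le> B"
proof -
  let ?S = "cbox (0::real^'n) 1 \<times> {0..T}"
  have "compact ?S" by (intro compact_Times compact_cbox) auto
  moreover have "continuous_on ?S (\<lambda>(x, s). F x s)"
    using cont by (rule continuous_on_subset) auto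
  ultimately have "bounded ((\<lambda>(x, s). F x s) ` ?S)"
    by (intro compact_imp_bounded compact_continuous_image)
  then obtain B where B: "\<And>x s. x \<in> cbox 0 1 \<Longrightarrow> s \<in> {0..T} \<Longrightarrow> \<bar>F x s\<bar> \<le> B"
    by (force simp: bounded_iff)
  show thesis
  proof (rule that[of "max 0 B"])
    fix x s assume s: "s \<in> {0..T}"
    obtain m :: "real^'n" where m: "\<And>i. m $ i \<in> \<int>" "x + m \<in> cbox 0 1"
      using torus_representative[of x] by blast
    with B[OF m(2) s] torus_periodicD[OF per[OF s] m(1), of x] show "\<bar>F x s\<bar> \<le> max 0 B" by simp
  qed simp
qed

lemma periodic_continuous_time_modulus:
  fixes F :: "real^'n \<Rightarrow> real \<Rightarrow> real"
  assumes per: "\<And>s. s \<in> {0..T} \<Longrightarrow> torus_periodic (\<lambda>x. F x s)"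
    and cont: "continuous_on (UNIV \<times> {0..T}) (\<lambda>(x, s). F x s)"
    and "0 < e"
  obtains r where "0 < r" "\<And>x s s'. s \<in> {0..T} \<Longrightarrow> s' \<in> {0..T} \<Longrightarrow> \<bar>s - s'\<bar> < r \<Longrightarrow> \<bar>F x s - F x s'\<bar> < e"
proof -
  let ?S = "cbox (0::real^'n) 1 \<times> {0..T}"
  have "compact ?S" by (intro compact_Times compact_cbox) auto
  moreover have "continuous_on ?S (\<lambda>(x, s). F x s)"
    using cont by (rule continuous_on_subset) auto
  ultimately have "uniformly_continuous_on ?S (\<lambda>(x, s). F x s)"
    by (rule compact_uniformly_continuous[rotated])
  then obtain r where r: "0 < r" "\<And>z z'. z \<in> ?S \<Longrightarrow> z' \<in> ?S \<Longrightarrow> dist z' z < r \<Longrightarrow>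
      dist ((\<lambda>(x, s). F x s) z') ((\<lambda>(x, s). F x s) z) < e"
    using \<open>0 < e\<close> unfolding uniformly_continuous_on_def by metis
  show thesis
  proof (rule that[OF r(1)])
    fix x s s' assume s: "s \<in> {0..T}" "s' \<in> {0..T}" "\<bar>s - s'\<bar> < r"
    obtain m :: "real^'n" where m: "\<And>i. m $ i \<in> \<int>" "x + m \<in> cbox 0 1"
      using torus_representative[of x] by blast
    have "\<bar>F (x + m) s - F (x + m) s'\<bar> < e"
      using r(2)[of "(x + m, s')" "(x + m, s)"] m(2) s by (simp add: dist_Pair_Pair dist_real_def)
    then show "\<bar>F x s - F x s'\<bar> < e"
      using torus_periodicD[OF per[OF s(1)] m(1), of x] torus_periodicD[OF per[OF s(2)] m(1), of x] by simp
  qed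
qed

text \<open>In the doubled functional the second time variable, \<open>k \<delta>\<close>, is discrete; at a maximum
  it can be moved by whole steps of the scheme.\<close>

definition penalized_max ::
  "real \<Rightarrow> nat \<Rightarrow> real \<Rightarrow> real \<Rightarrow> real \<Rightarrow> (real^'n \<Rightarrow> real \<Rightarrow> real) \<Rightarrow> (nat \<Rightarrow> real^'n \<Rightarrow> real) \<Rightarrow>
    real^'n \<Rightarrow> real \<Rightarrow> real^'n \<Rightarrow> nat \<Rightarrow> bool" where
  "penalized_max T n \<delta> \<epsilon> \<eta> F f x s y k \<longleftrightarrow>
     s \<in> {0..T} \<and> k \<le> n \<and>
     (\<forall>x' s' y' k'. s' \<in> {0..T} \<longrightarrow> k' \<le> n \<longrightarrow>
        F x' s' + f k' y' - penalty \<epsilon> \<eta> y' (real k' * \<delta>) x' s'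
          \<le> F x s + f k y - penalty \<epsilon> \<eta> y (real k * \<delta>) x s)"

lemma penalized_maxD:
  assumes "penalized_max T n \<delta> \<epsilon> \<eta> F f x s y k" "s' \<in> {0..T}" "k' \<le> n"
  shows "F x' s' + f k' y' - penalty \<epsilon> \<eta> y' (real k' * \<delta>) x' s'
          \<le> F x s + f k y - penalty \<epsilon> \<eta> y (real k * \<delta>) x s"
  using assms unfolding penalized_max_def by blast

text \<open>Translating \<open>x\<close> and \<open>y\<close> by the same integer vector changes nothing, so \<open>x\<close> may
  be taken in the unit cell; the penalty confines \<open>x - y\<close> to a ball. What is left to maximise
  over is compact in \<open>(x, s, x - y)\<close> and finite in \<open>k\<close>.\<close>

lemma penalized_maximum_exists:
  fixes F :: "real^'n \<Rightarrow> real \<Rightarrow> real" and f :: "nat \<Rightarrow> real^'n \<Rightarrow> real"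
  assumes F_per: "\<And>s. s \<in> {0..T} \<Longrightarrow> torus_periodic (\<lambda>x. F x s)"
    and F_cont: "continuous_on (UNIV \<times> {0..T}) (\<lambda>(x, s). F x s)"
    and f_per: "\<And>k. k \<le> n \<Longrightarrow> torus_periodic (f k)"
    and f_cont: "\<And>k. k \<le> n \<Longrightarrow> continuous_on UNIV (f k)"
    and B: "\<And>x s y k. s \<in> {0..T} \<Longrightarrow> k \<le> n \<Longrightarrow> F x s + f k y \<le> B"
    and pos: "0 < \<epsilon>" "0 \<le> \<eta>" "0 \<le> T"
  shows "\<exists>x s y k. penalized_max T n \<delta> \<epsilon> \<eta> F f x s y k"
proof -
  define \<Psi> where "\<Psi> x s y k = F x s + f k y - penalty \<epsilon> \<eta> y (real k * \<delta>) x s" for x s y k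
  \<comment> \<open>outside the ball of radius \<open>\<rho>\<close> the penalty brings the value down to at most \<open>\<Psi> 0 0 0 0\<close>\<close>
  define \<rho> where "\<rho> = sqrt (2 * \<epsilon> * max 0 (B - \<Psi> 0 0 0 0))"
  let ?S = "cbox (0::real^'n) 1 \<times> {0..T} \<times> cball (0::real^'n) \<rho>"
  have S0: "(0, 0, 0) \<in> ?S" using pos by (simp add: mem_box_cart \<rho>_def)
  have "\<exists>z\<in>?S. \<forall>z'\<in>?S. \<Psi> (fst z') (fst (snd z')) (fst z' - snd (snd z')) k
      \<le> \<Psi> (fst z) (fst (snd z)) (fst z - snd (snd z)) k" if k: "k \<le> n" for k
  proof (rule continuous_attains_sup)
    show "compact ?S" by (intro compact_Times compact_cbox compact_cball) auto
    show "?S \<noteq> {}" using S0 by blast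
    have "continuous_on ?S (\<lambda>z. (\<lambda>(x, s). F x s) (fst z, fst (snd z)))"
      by (rule continuous_on_compose2[OF F_cont]) (auto intro!: continuous_intros)
    moreover have "continuous_on ?S (\<lambda>z. f k (fst z - snd (snd z)))"
      by (rule continuous_on_compose2[OF f_cont[OF k]]) (auto intro!: continuous_intros)
    ultimately show "continuous_on ?S (\<lambda>z. \<Psi> (fst z) (fst (snd z)) (fst z - snd (snd z)) k)"
      unfolding \<Psi>_def penalty_def using pos(1) by (auto intro!: continuous_intros)
  qed
  then obtain z where z: "\<And>k. k \<le> n \<Longrightarrow> z k \<in> ?S" and
    z_max: "\<And>k z'. k \<le> n \<Longrightarrow> z' \<in> ?S \<Longrightarrow> \<Psi> (fst z') (fst (snd z')) (fst z' - snd (snd z')) k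
      \<le> \<Psi> (fst (z k)) (fst (snd (z k))) (fst (z k) - snd (snd (z k))) k"
    by metis
  define \<Phi> where "\<Phi> k = \<Psi> (fst (z k)) (fst (snd (z k))) (fst (z k) - snd (snd (z k))) k" for k
  obtain k where k: "k \<le> n" and k_max: "\<And>k'. k' \<le> n \<Longrightarrow> \<Phi> k' \<le> \<Phi> k"
  proof -
    have "Max (\<Phi> ` {..n}) \<in> \<Phi> ` {..n}" by (intro Max_in) auto
    then obtain k where "k \<in> {..n}" "Max (\<Phi> ` {..n}) = \<Phi> k" by (rule imageE)
    then show thesis using Max_ge[of "\<Phi> ` {..n}"] by (intro that[of k]) auto
  qed
  have "\<Psi> x' s' y' k' \<le> \<Phi> k" if s': "s' \<in> {0..T}" and k': "k' \<le> n" for x' s' y' k'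
  proof (cases "norm (x' - y') \<le> \<rho>")
    case True
    obtain m :: "real^'n" where m: "\<And>i. m $ i \<in> \<int>" "x' + m \<in> cbox 0 1"
      using torus_representative[of x'] by blast
    have "\<Psi> x' s' y' k' = \<Psi> (x' + m) s' (x' + m - (x' - y')) k'"
      using torus_periodicD[OF F_per[OF s'] m(1), of x'] torus_periodicD[OF f_per[OF k'] m(1), of y']
      by (simp add: \<Psi>_def penalty_def add.commute)
    also have "\<dots> \<le> \<Phi> k'"
      using z_max[OF k', of "(x' + m, s', x' - y')"] m(2) s' True by (simp add: \<Phi>_def)
    also have "\<dots> \<le> \<Phi> k" by (rule k_max[OF k'])
    finally show ?thesis .
  next
    case False
    moreover have "0 \<le> \<rho>" using pos by (simp add: \<rho>_def)
    ultimately have "\<rho>\<^sup>2 \<le> (norm (x' - y'))\<^sup>2" by (intro power_mono) auto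
    moreover have "2 * \<epsilon> * (B - \<Psi> 0 0 0 0) \<le> \<rho>\<^sup>2"
      using pos by (simp add: \<rho>_def)
    ultimately have "2 * \<epsilon> * (B - \<Psi> 0 0 0 0) \<le> (norm (x' - y'))\<^sup>2" by linarith
    then have "B - \<Psi> 0 0 0 0 \<le> (norm (x' - y'))\<^sup>2 / (2 * \<epsilon>)"
      using pos by (simp add: field_simps)
    moreover have "0 \<le> (s' - real k' * \<delta>)\<^sup>2 / (2 * \<epsilon>)" "0 \<le> \<eta> * s'" using pos s' by auto
    ultimately have "\<Psi> x' s' y' k' \<le> \<Psi> 0 0 0 0"
      using B[OF s' k', of x' y'] by (simp add: \<Psi>_def[of x'] penalty_def)
    also have "\<dots> \<le> \<Phi> 0" using z_max[of 0 "(0, 0, 0)"] S0 by (simp add: \<Phi>_def)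
    also have "\<dots> \<le> \<Phi> k" by (rule k_max) simp
    finally show ?thesis .
  qed
  then have "penalized_max T n \<delta> \<epsilon> \<eta> F f (fst (z k)) (fst (snd (z k))) (fst (z k) - snd (snd (z k))) k"
    using z[OF k] k by (auto simp: penalized_max_def \<Psi>_def \<Phi>_def)
  then show ?thesis by blast
qed

section \<open>Doubling of variables against a discrete evolution\<close>

text \<open>The comparison principle between a function \<open>F\<close> of continuous time and a discrete
  evolution \<open>- f\<close>. The two halves of the comparison with the scheme are \<open>F = v\<close>,
  \<open>f = - Z\<close> and \<open>F = - v\<close>, \<open>f = Z\<close>.
  The equations enter only through \<open>interior\<close>: at a maximum with positive times they force
  \<open>\<eta> \<le> M |x - y| + \<delta> (R\<^sup>2 + 1) / (2 \<epsilon>)\<close>. Because \<open>f\<close> is Lipschitz,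
  \<open>|x - y| \<le> 2 K \<epsilon>\<close>, so this fails for a fixed \<open>\<eta>\<close> once \<open>\<epsilon>\<close> and then
  \<open>\<delta>\<close> are small. The maximum therefore sits at an initial time, where the two functions cancel
  up to their moduli of continuity.

  The discrete times stop at \<open>t\<^sub>0 < T\<close>. The penalty then keeps \<open>s\<close> away from
  \<open>T\<close>, where the viscosity inequalities say nothing.\<close>

lemma doubling_comparison:
  fixes F :: "real^'n \<Rightarrow> real \<Rightarrow> real" and f :: "real \<Rightarrow> nat \<Rightarrow> real^'n \<Rightarrow> real"
  assumes F_per: "\<And>s. s \<in> {0..T} \<Longrightarrow> torus_periodic (\<lambda>x. F x s)"
    and F_cont: "continuous_on (UNIV \<times> {0..T}) (\<lambda>(x, s). F x s)"
    and f0: "\<And>\<delta> x. f \<delta> 0 x = - F x 0"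
    and f_per: "\<And>\<delta> k. torus_periodic (f \<delta> k)"
    and f_lip: "\<And>\<delta> k. 0 < \<delta> \<Longrightarrow> real k * \<delta> \<le> T \<Longrightarrow> K-lipschitz_on UNIV (f \<delta> k)"
    and f_time: "\<And>\<delta> k x. 0 < \<delta> \<Longrightarrow> real (Suc k) * \<delta> \<le> T \<Longrightarrow> \<bar>f \<delta> (Suc k) x - f \<delta> k x\<bar> \<le> C * \<delta>"
    and interior: "\<And>\<delta> \<epsilon> \<eta> n x s y k. 0 < \<delta> \<Longrightarrow> 0 < \<epsilon> \<Longrightarrow> real n * \<delta> \<le> T \<Longrightarrow> s \<in> {0<..<T} \<Longrightarrow>
        norm (x - y) \<le> 2 * K * \<epsilon> \<Longrightarrow> penalized_max T n \<delta> \<epsilon> \<eta> F (f \<delta>) x s y (Suc k) \<Longrightarrow>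
        \<eta> \<le> M * norm (x - y) + \<delta> * (R\<^sup>2 + 1) / (2 * \<epsilon>)"
    and C: "0 \<le> C" and M: "0 \<le> M"
    and t0: "0 \<le> t\<^sub>0" "t\<^sub>0 < T" and e: "0 < e"
  shows "\<exists>\<delta>\<^sub>0>0. \<forall>\<delta> n x. 0 < \<delta> \<longrightarrow> \<delta> < \<delta>\<^sub>0 \<longrightarrow> real n * \<delta> \<le> t\<^sub>0 \<longrightarrow> F x (real n * \<delta>) + f \<delta> n x \<le> e"
proof -
  have T: "0 < T" using t0 by simp
  have K: "0 \<le> K" using f_lip[of 1 0] T by (auto dest: lipschitz_on_nonneg)
  have small: "\<exists>h>0. c * h \<le> d" if "0 \<le> c" "0 < d" for c d :: real
    using that by (intro exI[of _ "d / (c + 1)"]) (auto simp: field_simps add_nonneg_pos)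
  obtain B where B0: "0 \<le> B" and B: "\<And>x s. s \<in> {0..T} \<Longrightarrow> \<bar>F x s\<bar> \<le> B"
    using periodic_continuous_bounded[OF F_per F_cont] by blast
  obtain r0 where r0: "0 < r0" and
    mod: "\<And>x s s'. s \<in> {0..T} \<Longrightarrow> s' \<in> {0..T} \<Longrightarrow> \<bar>s - s'\<bar> < r0 \<Longrightarrow> \<bar>F x s - F x s'\<bar> < e / 4"
    using periodic_continuous_time_modulus[OF F_per F_cont, of "e / 4"] e by auto
  obtain r1 where r1: "0 < r1" "C * r1 \<le> e / 8" using small[OF C, of "e / 8"] e by auto
  define r where "r = min ((T - t\<^sub>0) / 2) (min (r0 / 2) r1)"
  have r: "0 < r" "r < T - t\<^sub>0" "r < r0" "r \<le> r1"
    using t0 r0 r1 by (auto simp: r_def min_less_iff_disj)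
  have Cr: "C * r \<le> e / 8"
    using order_trans[OF mult_left_mono[OF r(4) C] r1(2)] .
  define B' where "B' = 2 * B + C * T"
  have B': "0 \<le> B'" using B0 C T by (simp add: B'_def)
  \<comment> \<open>over the whole time interval, this drift costs half of the tolerance \<open>e\<close>\<close>
  define \<eta> where "\<eta> = e / (2 * T)"
  have \<eta>: "0 < \<eta>" using e T by (simp add: \<eta>_def)
  obtain \<epsilon>1 where \<epsilon>1: "0 < \<epsilon>1" "2 * K\<^sup>2 * \<epsilon>1 \<le> e / 8" using small[of "2 * K\<^sup>2" "e / 8"] e by auto
  obtain \<epsilon>2 where \<epsilon>2: "0 < \<epsilon>2" "2 * B' * \<epsilon>2 \<le> r\<^sup>2" using small[of "2 * B'" "r\<^sup>2"] B' r by auto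
  obtain \<epsilon>3 where \<epsilon>3: "0 < \<epsilon>3" "M * (2 * K) * \<epsilon>3 \<le> \<eta> / 4"
    using small[of "M * (2 * K)" "\<eta> / 4"] M K \<eta> by auto
  define \<epsilon> where "\<epsilon> = min \<epsilon>1 (min \<epsilon>2 \<epsilon>3)"
  have \<epsilon>: "0 < \<epsilon>" using \<epsilon>1 \<epsilon>2 \<epsilon>3 by (simp add: \<epsilon>_def)
  have \<epsilon>_le: "\<epsilon> \<le> \<epsilon>1" "\<epsilon> \<le> \<epsilon>2" "\<epsilon> \<le> \<epsilon>3" by (simp_all add: \<epsilon>_def)
  have K\<epsilon>: "2 * K\<^sup>2 * \<epsilon> \<le> e / 8"
    by (rule order_trans[OF mult_left_mono[OF \<epsilon>_le(1)] \<epsilon>1(2)]) simp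
  have B\<epsilon>: "2 * B' * \<epsilon> \<le> r\<^sup>2"
    by (rule order_trans[OF mult_left_mono[OF \<epsilon>_le(2)] \<epsilon>2(2)]) (use B' in simp)
  have M\<epsilon>: "M * (2 * K * \<epsilon>) \<le> \<eta> / 4"
    using order_trans[OF mult_left_mono[OF \<epsilon>_le(3)] \<epsilon>3(2)] M K by (simp add: mult.assoc)
  obtain \<delta>\<^sub>0 where \<delta>0: "0 < \<delta>\<^sub>0" "(R\<^sup>2 + 1) / (2 * \<epsilon>) * \<delta>\<^sub>0 \<le> \<eta> / 4"
    using small[of "(R\<^sup>2 + 1) / (2 * \<epsilon>)" "\<eta> / 4"] \<epsilon> \<eta> by auto
  show ?thesis
  proof (intro exI[of _ \<delta>\<^sub>0] conjI allI impI \<delta>0(1))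
    fix \<delta> n x0
    assume \<delta>: "0 < \<delta>" "\<delta> < \<delta>\<^sub>0" and n: "real n * \<delta> \<le> t\<^sub>0"
    have kt: "0 \<le> real k * \<delta>" "real k * \<delta> \<le> t\<^sub>0" "real k * \<delta> \<le> T" if "k \<le> n" for k
    proof -
      have "real k * \<delta> \<le> real n * \<delta>" using that \<delta> by (intro mult_right_mono) auto
      then show "real k * \<delta> \<le> t\<^sub>0" using n by simp
      then show "real k * \<delta> \<le> T" using t0 by simp
    qed (use \<delta> in simp)
    note lip = f_lip[OF \<delta>(1) kt(3)]
    have f_drift: "\<bar>f \<delta> k y - f \<delta> 0 y\<bar> \<le> C * (real k * \<delta>)" if "k \<le> n" for k y
      using that
    proof (induction k)
      case (Suc k)
      then show ?case using f_time[OF \<delta>(1) kt(3), of k y] by (simp add: algebra_simps)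
    qed simp
    have bound: "F x s + f \<delta> k y \<le> B'" if "s \<in> {0..T}" "k \<le> n" for x s k y
    proof -
      have "C * (real k * \<delta>) \<le> C * T" using kt[OF that(2)] C by (intro mult_left_mono) auto
      then show ?thesis
        using B[OF that(1), of x] B[of 0 y] f_drift[OF that(2), of y] f0[of \<delta> y] T
        by (simp add: B'_def abs_le_iff)
    qed
    obtain x s y k where max: "penalized_max T n \<delta> \<epsilon> \<eta> F (f \<delta>) x s y k"
      using penalized_maximum_exists[where f = "f \<delta>" and n = n and B = B',
        OF F_per F_cont f_per lipschitz_on_continuous_on[OF lip] bound \<epsilon> less_imp_le[OF \<eta>] less_imp_le[OF T]]
      by blast
    have s: "s \<in> {0..T}" and k: "k \<le> n" using max by (auto simp: penalized_max_def)
    have f_xy: "f \<delta> k y - f \<delta> k x \<le> K * norm (x - y)"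
      using lipschitz_onD[OF lip[OF k], of y x] by (simp add: dist_norm norm_minus_commute abs_le_iff)
    have xy: "norm (x - y) \<le> 2 * K * \<epsilon>"
    proof (cases "x = y")
      case False
      have "(norm (x - y))\<^sup>2 / (2 * \<epsilon>) \<le> f \<delta> k y - f \<delta> k x"
        using penalized_maxD[OF max s k, of x x] by (simp add: penalty_def)
      with f_xy have "(norm (x - y))\<^sup>2 / (2 * \<epsilon>) \<le> K * norm (x - y)" by simp
      then have "norm (x - y) * norm (x - y) \<le> (2 * K * \<epsilon>) * norm (x - y)"
        using \<epsilon> by (simp add: field_simps power2_eq_square)
      then show ?thesis using False by simp
    qed (use K \<epsilon> in simp)
    have pen: "0 \<le> (norm (x - y))\<^sup>2 / (2 * \<epsilon>)" "0 \<le> \<eta> * s" "0 \<le> (s - real k * \<delta>)\<^sup>2 / (2 * \<epsilon>)"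
      using \<epsilon> \<eta> s by auto
    have sk: "\<bar>s - real k * \<delta>\<bar> \<le> r"
    proof -
      have "(s - real k * \<delta>)\<^sup>2 / (2 * \<epsilon>) \<le> B'"
        using penalized_maxD[OF max, of 0 0 0 0] T bound[OF s k, of x y] pen by (simp add: penalty_def f0)
      then have "(s - real k * \<delta>)\<^sup>2 \<le> r\<^sup>2" using B\<epsilon> \<epsilon> by (simp add: field_simps)
      then show ?thesis using r by (simp add: abs_le_square_iff[symmetric])
    qed
    have initial: "s = 0 \<or> k = 0"
    proof (rule ccontr)
      assume *: "\<not> (s = 0 \<or> k = 0)"
      then obtain j where j: "k = Suc j" by (cases k) auto
      have "s < T" using sk kt(2)[OF k] r by (simp add: abs_le_iff)
      then have "s \<in> {0<..<T}" using * s by simp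
      from interior[OF \<delta>(1) \<epsilon> kt(3)[OF order_refl] this xy max[unfolded j]]
      have "\<eta> \<le> M * norm (x - y) + \<delta> * (R\<^sup>2 + 1) / (2 * \<epsilon>)" .
      also have "M * norm (x - y) \<le> \<eta> / 4"
        using M\<epsilon> mult_left_mono[OF xy M] by linarith
      also have "\<delta> * (R\<^sup>2 + 1) / (2 * \<epsilon>) \<le> \<eta> / 4"
        using \<delta>0(2) mult_left_mono[of \<delta> \<delta>\<^sub>0 "(R\<^sup>2 + 1) / (2 * \<epsilon>)"] \<delta> \<epsilon> by (simp add: mult.commute)
      finally show False using \<eta> by simp
    qed
    have sr: "\<bar>s - 0\<bar> < r0" and kr: "real k * \<delta> \<le> r" using initial sk r s by auto
    have "F x s + f \<delta> k y \<le> e / 2"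
    proof -
      have "K * norm (x - y) \<le> K * (2 * K * \<epsilon>)" using xy K by (intro mult_left_mono)
      also have "\<dots> \<le> e / 8" using K\<epsilon> by (simp add: power2_eq_square algebra_simps)
      finally have "f \<delta> k y - f \<delta> k x \<le> e / 8" using f_xy by simp
      moreover have "C * (real k * \<delta>) \<le> C * r" using kr C by (intro mult_left_mono)
      moreover have "\<bar>F x s - F x 0\<bar> < e / 4" using mod[OF s _ sr, of x] T by simp
      ultimately show ?thesis
        using f_drift[OF k, of x] Cr f0[of \<delta> x] by linarith
    qed
    moreover have "F x0 (real n * \<delta>) + f \<delta> n x0 - \<eta> * (real n * \<delta>) \<le> F x s + f \<delta> k y"
      using penalized_maxD[OF max, of "real n * \<delta>" n x0 x0] kt[of n] pen by (simp add: penalty_def)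
    moreover have "\<eta> * (real n * \<delta>) \<le> \<eta> * T" using kt[of n] \<eta> by (intro mult_left_mono) auto
    moreover have "\<eta> * T = e / 2" using T by (simp add: \<eta>_def)
    ultimately show "F x0 (real n * \<delta>) + f \<delta> n x0 \<le> e" by linarith
  qed
qed

text \<open>The Hamilton--Jacobi problem in forward time. The function \<open>H0\<close> is tied to \<open>L\<close>
  by the Fenchel inequality and its equality case, with optimal controls bounded on balls of momenta.\<close>

locale hj_problem = sl_scheme L V g KV Kg T
  for L V g :: "real^'n \<Rightarrow> real" and KV Kg T :: real +
  fixes H0 :: "real^'n \<Rightarrow> real" and v :: "real^'n \<Rightarrow> real \<Rightarrow> real"
  assumes V_periodic: "torus_periodic V" and g_periodic: "torus_periodic g"
    and fenchel: "a \<bullet> p \<le> L a + H0 p"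
    and fenchel_attained: "\<exists>A. \<forall>p. norm p \<le> \<rho> \<longrightarrow> (\<exists>a. norm a \<le> A \<and> L a + H0 p \<le> a \<bullet> p)"
    and solution: "viscosity_solution_forward (\<lambda>x p. H0 p - V x) T g v"
begin

lemma v_periodic: "s \<in> {0..T} \<Longrightarrow> torus_periodic (\<lambda>x. v x s)"
  and v_continuous: "continuous_on (UNIV \<times> {0..T}) (\<lambda>(x, s). v x s)"
  and v_sub: "viscosity_subsolution (\<lambda>x p. H0 p - V x) T v"
  and v_super: "viscosity_supersolution (\<lambda>x p. H0 p - V x) T v"
  and v_initial: "v x 0 = g x"
  using solution by (auto simp: viscosity_solution_forward_def)

lemma Z_periodic: "torus_periodic (Z \<delta> k)"
proof (induction k)
  case 0 then show ?case using g_periodic by simp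
next
  case (Suc k)
  show ?case unfolding torus_periodic_def
  proof (intro allI impI)
    fix x m :: "real^'n" assume m: "\<forall>i. m $ i \<in> \<int>"
    have "Z \<delta> k (x + m - \<delta> *\<^sub>R a) = Z \<delta> k (x - \<delta> *\<^sub>R a)" for a
      using torus_periodicD[OF Suc, of m "x - \<delta> *\<^sub>R a"] m by (simp add: algebra_simps)
    moreover have "V (x + m) = V x" using torus_periodicD[OF V_periodic, of m x] m by simp
    ultimately show "Z \<delta> (Suc k) (x + m) = Z \<delta> (Suc k) x" by (simp add: sl_iter_Suc sl_step_def)
  qed
qed

lemma V_bounded: obtains B where "0 \<le> B" "\<And>x. \<bar>V x\<bar> \<le> B"
proof -
  have "continuous_on (UNIV \<times> {0..0::real}) (\<lambda>(x, s). V x)"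
    unfolding case_prod_unfold
    by (rule continuous_on_compose2[OF lipschitz_on_continuous_on[OF V_lipschitz]])
       (auto intro!: continuous_intros)
  from periodic_continuous_bounded[OF V_periodic this] show thesis using that by (metis atLeastAtMost_singleton insertI1)
qed

text \<open>The change of the penalty under one step back of the scheme. To first order in \<open>\<delta>\<close> it
  consists of \<open>a \<bullet> p\<close>, where \<open>p\<close> is the space gradient of the penalty, and of the time
  derivative of the quadratic part; the remainder is the \<open>\<delta> / \<epsilon>\<close> term of the comparison.\<close>

lemma shifted_penalty:
  fixes x y a :: "real^'n"
  assumes "\<epsilon> > 0"
  shows "penalty \<epsilon> \<eta> (y - \<delta> *\<^sub>R a) (c - \<delta>) x s
     = penalty \<epsilon> \<eta> y c x s + \<delta> * (a \<bullet> ((1 / \<epsilon>) *\<^sub>R (x - y)) + (s - c) / \<epsilon> + \<delta> * ((norm a)\<^sup>2 + 1) / (2 * \<epsilon>))"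
proof -
  have "(norm (x - (y - \<delta> *\<^sub>R a)))\<^sup>2 = (norm (x - y))\<^sup>2 + 2 * \<delta> * (a \<bullet> (x - y)) + \<delta>\<^sup>2 * (norm a)\<^sup>2"
    unfolding power2_norm_eq_inner by (simp add: algebra_simps inner_commute power2_eq_square)
  then show ?thesis
    using assms unfolding penalty_def inner_scaleR_right by (simp add: field_simps power2_eq_square)
qed

text \<open>At the maximum, the scheme can be tested at the previous time level with a nearly optimal
  control: this makes it satisfy, up to \<open>O(\<delta> / \<epsilon>)\<close>, the supersolution inequality at \<open>y\<close>
  for the same \<open>p\<close> as the subsolution inequality for \<open>v\<close> at \<open>x\<close>. The
  time derivatives differ by \<open>\<eta>\<close>, which only \<open>v\<close> feels, and the Hamiltonians by
  \<open>V x - V y\<close>.\<close>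

lemma subsolution_interior_max:
  assumes R: "\<And>\<delta> k x c. 0 < \<delta> \<Longrightarrow> real k * \<delta> \<le> T \<Longrightarrow> Z \<delta> (Suc k) x < c \<Longrightarrow>
       \<exists>a. norm a \<le> R \<and> Z \<delta> k (x - \<delta> *\<^sub>R a) + \<delta> * (L a + V x) < c"
    and \<delta>: "0 < \<delta>" and \<epsilon>: "0 < \<epsilon>" and n: "real n * \<delta> \<le> T" and s: "s \<in> {0<..<T}"
    and max: "penalized_max T n \<delta> \<epsilon> \<eta> v (\<lambda>k y. - Z \<delta> k y) x s y (Suc k)"
  shows "\<eta> \<le> KV * norm (x - y) + \<delta> * (R\<^sup>2 + 1) / (2 * \<epsilon>)"
proof -
  have kn: "Suc k \<le> n" using max by (simp add: penalized_max_def)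
  then have "real (Suc k) * \<delta> \<le> real n * \<delta>" using \<delta> by (intro mult_right_mono) auto
  then have k: "real (Suc k) * \<delta> \<le> T" using n by simp
  let ?c = "real (Suc k) * \<delta>" and ?p = "(1 / \<epsilon>) *\<^sub>R (x - y)"
  let ?E = "\<delta> * (R\<^sup>2 + 1) / (2 * \<epsilon>)"
  have sub: "(s - ?c) / \<epsilon> + \<eta> + (H0 ?p - V x) \<le> 0"
    proof (rule subsolution_at_penalized_max[OF v_sub \<epsilon> s])
    fix x' s' assume "s' \<in> {0..T}"
    from penalized_maxD[OF max this kn, of x' y]
    show "v x' s' - penalty \<epsilon> \<eta> y ?c x' s' \<le> v x s - penalty \<epsilon> \<eta> y ?c x s" by simp
  qed
  have "\<delta> * (V y) \<le> \<delta> * (H0 ?p + (s - ?c) / \<epsilon> + ?E)"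
  proof (rule field_le_epsilon)
    fix e :: real assume "0 < e"
    then obtain a where a: "norm a \<le> R"
      "Z \<delta> k (y - \<delta> *\<^sub>R a) + \<delta> * (L a + V y) < Z \<delta> (Suc k) y + e"
      using R[OF \<delta>, of k y "Z \<delta> (Suc k) y + e"] k \<delta> by (auto simp: algebra_simps)
    have ck: "real k * \<delta> = ?c - \<delta>" by (simp add: algebra_simps)
    have "Z \<delta> (Suc k) y - Z \<delta> k (y - \<delta> *\<^sub>R a)
       \<le> \<delta> * (a \<bullet> ?p + (s - ?c) / \<epsilon> + \<delta> * ((norm a)\<^sup>2 + 1) / (2 * \<epsilon>))"
      using penalized_maxD[OF max, of s k x "y - \<delta> *\<^sub>R a"] s kn shifted_penalty[OF \<epsilon>, of \<eta> y \<delta> a ?c x s]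
      unfolding ck by simp
    also have "\<dots> \<le> \<delta> * (L a + H0 ?p + (s - ?c) / \<epsilon> + ?E)"
    proof -
      have "(norm a)\<^sup>2 \<le> R\<^sup>2" using a(1) by (intro power_mono) auto
      then have "\<delta> * ((norm a)\<^sup>2 + 1) / (2 * \<epsilon>) \<le> ?E"
        using \<delta> \<epsilon> by (intro divide_right_mono mult_left_mono) auto
      then show ?thesis using fenchel[of a ?p] \<delta> by (intro mult_left_mono) auto
    qed
    finally show "\<delta> * V y \<le> \<delta> * (H0 ?p + (s - ?c) / \<epsilon> + ?E) + e"
      using a(2) by (simp add: distrib_left)
  qed
  then have "V y \<le> H0 ?p + (s - ?c) / \<epsilon> + ?E" using \<delta> by simp
  then show ?thesis using sub V_diff[of x y] by (simp add: abs_le_iff)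
qed

text \<open>The mirror image. Now the scheme has to satisfy a subsolution inequality, and it is enough to
  insert one control, the one that attains \<open>H0 p\<close> in the Fenchel inequality. It is bounded
  because \<open>|p| \<le> \<rho>\<close>.\<close>

lemma supersolution_interior_max:
  assumes \<delta>: "0 < \<delta>" and \<epsilon>: "0 < \<epsilon>" and n: "real n * \<delta> \<le> T" and s: "s \<in> {0<..<T}"
    and A: "\<And>p. norm p \<le> \<rho> \<Longrightarrow> \<exists>a. norm a \<le> A \<and> L a + H0 p \<le> a \<bullet> p"
    and xy: "norm (x - y) \<le> \<rho> * \<epsilon>"
    and max: "penalized_max T n \<delta> \<epsilon> \<eta> (\<lambda>x s. - v x s) (Z \<delta>) x s y (Suc k)"
  shows "\<eta> \<le> KV * norm (x - y) + \<delta> * (A\<^sup>2 + 1) / (2 * \<epsilon>)"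
proof -
  have kn: "Suc k \<le> n" using max by (simp add: penalized_max_def)
  then have "real (Suc k) * \<delta> \<le> real n * \<delta>" using \<delta> by (intro mult_right_mono) auto
  then have k: "real (Suc k) * \<delta> \<le> T" using n by simp
  let ?c = "real (Suc k) * \<delta>" and ?p = "(1 / \<epsilon>) *\<^sub>R (y - x)"
  let ?E = "\<delta> * (A\<^sup>2 + 1) / (2 * \<epsilon>)"
  have super: "(s - ?c) / \<epsilon> + \<eta> \<le> H0 ?p - V x"
    proof (rule supersolution_at_penalized_min[OF v_super \<epsilon> s])
    fix x' s' assume "s' \<in> {0..T}"
    from penalized_maxD[OF max this kn, of x' y]
    show "v x s + penalty \<epsilon> \<eta> y ?c x s \<le> v x' s' + penalty \<epsilon> \<eta> y ?c x' s'" by simp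
  qed
  have "norm ?p \<le> \<rho>"
    using xy \<epsilon> unfolding norm_scaleR by (simp add: field_simps norm_minus_commute)
  then obtain a where a: "norm a \<le> A" "L a + H0 ?p \<le> a \<bullet> ?p" using A by blast
  have ck: "real k * \<delta> = ?c - \<delta>" by (simp add: algebra_simps)
  have flip: "a \<bullet> ((1 / \<epsilon>) *\<^sub>R (x - y)) = - (a \<bullet> ?p)" by (simp add: inner_diff_right diff_divide_distrib)
  have "Z \<delta> (Suc k) y \<le> Z \<delta> k (y - \<delta> *\<^sub>R a) + \<delta> * (L a + V y)"
    using Z_Suc_le[of \<delta> k y a] \<delta> k by (simp add: algebra_simps)
  moreover have "Z \<delta> k (y - \<delta> *\<^sub>R a) - Z \<delta> (Suc k) y
       \<le> \<delta> * (- (a \<bullet> ?p) + (s - ?c) / \<epsilon> + \<delta> * ((norm a)\<^sup>2 + 1) / (2 * \<epsilon>))"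
    using penalized_maxD[OF max, of s k x "y - \<delta> *\<^sub>R a"] s kn shifted_penalty[OF \<epsilon>, of \<eta> y \<delta> a ?c x s]
    unfolding ck flip by simp
  ultimately have "0 \<le> \<delta> * (L a + V y - a \<bullet> ?p + (s - ?c) / \<epsilon> + \<delta> * ((norm a)\<^sup>2 + 1) / (2 * \<epsilon>))"
    by (simp add: algebra_simps)
  then have "0 \<le> L a + V y - a \<bullet> ?p + (s - ?c) / \<epsilon> + \<delta> * ((norm a)\<^sup>2 + 1) / (2 * \<epsilon>)"
    using \<delta> by (simp add: zero_le_mult_iff)
  moreover have "\<delta> * ((norm a)\<^sup>2 + 1) / (2 * \<epsilon>) \<le> ?E"
  proof -
    have "(norm a)\<^sup>2 \<le> A\<^sup>2" using a(1) by (intro power_mono) auto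
    then show ?thesis using \<delta> \<epsilon> by (intro divide_right_mono mult_left_mono) auto
  qed
  ultimately show ?thesis using super a(2) V_diff[of x y] by (simp add: abs_le_iff)
qed

section \<open>The sup-norm error of the scheme\<close>

lemma Z_uniform_bounds:
  obtains C where "0 \<le> C"
    "\<And>\<delta> k x. 0 \<le> \<delta> \<Longrightarrow> real (Suc k) * \<delta> \<le> T \<Longrightarrow> \<bar>Z \<delta> (Suc k) x - Z \<delta> k x\<bar> \<le> C * \<delta>"
proof -
  obtain B where "\<And>x. \<bar>V x\<bar> \<le> B" using V_bounded by blast
  then show thesis using that by (rule Z_time_lipschitz)
qed

lemma subsolution_below_limit:
  assumes t0: "0 \<le> t\<^sub>0" "t\<^sub>0 < T" and e: "0 < e"
  shows "\<exists>\<delta>\<^sub>0>0. \<forall>\<delta> n x. 0 < \<delta> \<longrightarrow> \<delta> < \<delta>\<^sub>0 \<longrightarrow> real n * \<delta> \<le> t\<^sub>0 \<longrightarrow> v x (real n * \<delta>) + - Z \<delta> n x \<le> e"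
proof -
  obtain R where R: "0 \<le> R" "\<And>\<delta> k x c. 0 < \<delta> \<Longrightarrow> real k * \<delta> \<le> T \<Longrightarrow> Z \<delta> (Suc k) x < c \<Longrightarrow>
       \<exists>a. norm a \<le> R \<and> Z \<delta> k (x - \<delta> *\<^sub>R a) + \<delta> * (L a + V x) < c"
    using Z_bounded_controls by blast
  obtain C where C: "0 \<le> C"
    "\<And>\<delta> k x. 0 \<le> \<delta> \<Longrightarrow> real (Suc k) * \<delta> \<le> T \<Longrightarrow> \<bar>Z \<delta> (Suc k) x - Z \<delta> k x\<bar> \<le> C * \<delta>"
    using Z_uniform_bounds by blast
  show ?thesis
  proof (rule doubling_comparison[where K = K and C = C and M = KV and R = R, OF v_periodic v_continuous])
    show "- Z \<delta> 0 x = - v x 0" for \<delta> x by (simp add: v_initial)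
    show "torus_periodic (\<lambda>y. - Z \<delta> k y)" for \<delta> k
      using Z_periodic[of \<delta> k] by (simp add: torus_periodic_def)
    show "K-lipschitz_on UNIV (\<lambda>y. - Z \<delta> k y)" if "0 < \<delta>" "real k * \<delta> \<le> T" for \<delta> k
      using Z_lipschitz[OF less_imp_le[OF that(1)] that(2)] by (auto simp: lipschitz_on_def dist_minus)
    show "\<bar>- Z \<delta> (Suc k) x - - Z \<delta> k x\<bar> \<le> C * \<delta>" if "0 < \<delta>" "real (Suc k) * \<delta> \<le> T" for \<delta> k x
      using C(2)[of \<delta> k x] that by (simp add: abs_minus_commute)
    show "\<eta> \<le> KV * norm (x - y) + \<delta> * (R\<^sup>2 + 1) / (2 * \<epsilon>)"
      if "0 < \<delta>" "0 < \<epsilon>" "real n * \<delta> \<le> T" "s \<in> {0<..<T}" "norm (x - y) \<le> 2 * K * \<epsilon>"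
        "penalized_max T n \<delta> \<epsilon> \<eta> v (\<lambda>y. \<lambda>x. - Z \<delta> y x) x s y (Suc k)" for \<delta> \<epsilon> \<eta> n x s y k
      by (rule subsolution_interior_max[OF R(2) that(1-4,6)])
  qed (use t0 e C KV_nonneg in auto)
qed

lemma supersolution_above_limit:
  assumes t0: "0 \<le> t\<^sub>0" "t\<^sub>0 < T" and e: "0 < e"
  shows "\<exists>\<delta>\<^sub>0>0. \<forall>\<delta> n x. 0 < \<delta> \<longrightarrow> \<delta> < \<delta>\<^sub>0 \<longrightarrow> real n * \<delta> \<le> t\<^sub>0 \<longrightarrow> - v x (real n * \<delta>) + Z \<delta> n x \<le> e"
proof -
  obtain A where A: "\<And>p. norm p \<le> 2 * K \<Longrightarrow> \<exists>a. norm a \<le> A \<and> L a + H0 p \<le> a \<bullet> p"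
    using fenchel_attained[of "2 * K"] by blast
  obtain C where C: "0 \<le> C"
    "\<And>\<delta> k x. 0 \<le> \<delta> \<Longrightarrow> real (Suc k) * \<delta> \<le> T \<Longrightarrow> \<bar>Z \<delta> (Suc k) x - Z \<delta> k x\<bar> \<le> C * \<delta>"
    using Z_uniform_bounds by blast
  have neg_per: "torus_periodic (\<lambda>x. - v x s)" if "s \<in> {0..T}" for s
    using v_periodic[OF that] by (simp add: torus_periodic_def)
  have neg_cont: "continuous_on (UNIV \<times> {0..T}) (\<lambda>(x, s). - v x s)"
    using continuous_on_minus[OF v_continuous] by (simp add: case_prod_unfold)
  show ?thesis
  proof (rule doubling_comparison[where K = K and C = C and M = KV and R = A, OF neg_per neg_cont])
    show "Z \<delta> 0 x = - (- v x 0)" for \<delta> x by (simp add: v_initial)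
    show "torus_periodic (Z \<delta> k)" for \<delta> k by (rule Z_periodic)
    show "K-lipschitz_on UNIV (Z \<delta> k)" if "0 < \<delta>" "real k * \<delta> \<le> T" for \<delta> k
      using Z_lipschitz[OF less_imp_le[OF that(1)] that(2)] .
    show "\<bar>Z \<delta> (Suc k) x - Z \<delta> k x\<bar> \<le> C * \<delta>" if "0 < \<delta>" "real (Suc k) * \<delta> \<le> T" for \<delta> k x
      using C(2)[of \<delta> k x] that by simp
    show "\<eta> \<le> KV * norm (x - y) + \<delta> * (A\<^sup>2 + 1) / (2 * \<epsilon>)"
      if "0 < \<delta>" "0 < \<epsilon>" "real n * \<delta> \<le> T" "s \<in> {0<..<T}" "norm (x - y) \<le> 2 * K * \<epsilon>"
        "penalized_max T n \<delta> \<epsilon> \<eta> (\<lambda>x s. - v x s) (Z \<delta>) x s y (Suc k)" for \<delta> \<epsilon> \<eta> n x s y k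
      by (rule supersolution_interior_max[OF that(1-4) A that(5,6)])
  qed (use t0 e C KV_nonneg in auto)
qed

lemma fine_step:
  assumes "0 < \<Delta>" "0 < (d::real)"
  obtains m :: nat where "0 < m" "\<Delta> / real m < d"
proof -
  obtain m :: nat where "\<Delta> / d < real m" using reals_Archimedean2 by blast
  moreover then have "0 < m" using assms by (cases m) (auto simp: divide_less_0_iff)
  ultimately show thesis using assms by (intro that[of m]) (auto simp: field_simps)
qed

text \<open>Apply the refinement bound with \<open>\<Delta>\<close> divided by \<open>m\<close>, and let \<open>m\<close> tend to
  infinity: the refined scheme tends to \<open>v\<close>, and the bound
  \<open>C \<Delta>\<close> remains.\<close>

lemma scheme_error_before_horizon:
  obtains C where "0 \<le> C"
    "\<And>\<Delta> k x. 0 < \<Delta> \<Longrightarrow> real k * \<Delta> < T \<Longrightarrow> \<bar>Z \<Delta> k x - v x (real k * \<Delta>)\<bar> \<le> C * \<Delta>"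
proof -
  obtain C where C: "0 \<le> C" "\<And>\<Delta> m k x. 0 < \<Delta> \<Longrightarrow> 0 < m \<Longrightarrow> real k * \<Delta> \<le> T \<Longrightarrow>
        \<bar>Z (\<Delta> / real m) (k * m) x - Z \<Delta> k x\<bar> \<le> C * \<Delta>"
    using Z_refinement by blast
  show thesis
  proof (rule that[OF C(1)])
    fix \<Delta> k x assume \<Delta>: "0 < \<Delta>" and k: "real k * \<Delta> < T"
    have k0: "0 \<le> real k * \<Delta>" using \<Delta> by simp
    show "\<bar>Z \<Delta> k x - v x (real k * \<Delta>)\<bar> \<le> C * \<Delta>"
    proof (rule field_le_epsilon)
      fix e :: real assume e: "0 < e"
      obtain d where d: "0 < d" "\<And>\<delta> n x. 0 < \<delta> \<Longrightarrow> \<delta> < d \<Longrightarrow> real n * \<delta> \<le> real k * \<Delta> \<Longrightarrow>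
          v x (real n * \<delta>) + - Z \<delta> n x \<le> e"
        using subsolution_below_limit[OF k0 k e] by blast
      obtain d' where d': "0 < d'" "\<And>\<delta> n x. 0 < \<delta> \<Longrightarrow> \<delta> < d' \<Longrightarrow> real n * \<delta> \<le> real k * \<Delta> \<Longrightarrow>
          - v x (real n * \<delta>) + Z \<delta> n x \<le> e"
        using supersolution_above_limit[OF k0 k e] by blast
      obtain m where m: "0 < m" "\<Delta> / real m < min d d'"
        using fine_step[OF \<Delta>, of "min d d'"] d(1) d'(1) by auto
      have km: "real (k * m) * (\<Delta> / real m) = real k * \<Delta>" using m by simp
      have "0 < \<Delta> / real m" using \<Delta> m by simp
      then have "\<bar>Z (\<Delta> / real m) (k * m) x - v x (real k * \<Delta>)\<bar> \<le> e"
        using d(2)[of "\<Delta> / real m" "k * m" x] d'(2)[of "\<Delta> / real m" "k * m" x] m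
        unfolding km by (simp add: abs_le_iff)
      then show "\<bar>Z \<Delta> k x - v x (real k * \<Delta>)\<bar> \<le> C * \<Delta> + e"
        using C(2)[OF \<Delta> m(1) less_imp_le[OF k], of x] by linarith
    qed
  qed
qed

text \<open>Only the time \<open>T\<close> itself is new. One step of a fine refinement earlier, the previous bound
  holds; the scheme is Lipschitz in time, and \<open>v\<close> is continuous up to \<open>T\<close>.\<close>

theorem scheme_error:
  assumes "0 < T"
  obtains C where "0 \<le> C"
    "\<And>\<Delta> k x. 0 < \<Delta> \<Longrightarrow> real k * \<Delta> \<le> T \<Longrightarrow> \<bar>Z \<Delta> k x - v x (real k * \<Delta>)\<bar> \<le> C * \<Delta>"
proof -
  obtain C\<^sub>1 where C1: "0 \<le> C\<^sub>1" "\<And>\<Delta> m k x. 0 < \<Delta> \<Longrightarrow> 0 < m \<Longrightarrow> real k * \<Delta> \<le> T \<Longrightarrow>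
        \<bar>Z (\<Delta> / real m) (k * m) x - Z \<Delta> k x\<bar> \<le> C\<^sub>1 * \<Delta>"
    using Z_refinement by blast
  obtain C\<^sub>2 where C2: "0 \<le> C\<^sub>2"
    "\<And>\<delta> k x. 0 \<le> \<delta> \<Longrightarrow> real (Suc k) * \<delta> \<le> T \<Longrightarrow> \<bar>Z \<delta> (Suc k) x - Z \<delta> k x\<bar> \<le> C\<^sub>2 * \<delta>"
    using Z_uniform_bounds by blast
  obtain C\<^sub>3 where C3: "0 \<le> C\<^sub>3"
    "\<And>\<Delta> k x. 0 < \<Delta> \<Longrightarrow> real k * \<Delta> < T \<Longrightarrow> \<bar>Z \<Delta> k x - v x (real k * \<Delta>)\<bar> \<le> C\<^sub>3 * \<Delta>"
    using scheme_error_before_horizon by blast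
  show thesis
  proof (rule that[of "C\<^sub>1 + C\<^sub>2 + C\<^sub>3"])
    show "0 \<le> C\<^sub>1 + C\<^sub>2 + C\<^sub>3" using C1(1) C2(1) C3(1) by simp
    fix \<Delta> k x assume \<Delta>: "0 < \<Delta>" and k: "real k * \<Delta> \<le> T"
    show "\<bar>Z \<Delta> k x - v x (real k * \<Delta>)\<bar> \<le> (C\<^sub>1 + C\<^sub>2 + C\<^sub>3) * \<Delta>"
    proof (rule field_le_epsilon)
      fix e :: real assume e: "0 < e"
      show "\<bar>Z \<Delta> k x - v x (real k * \<Delta>)\<bar> \<le> (C\<^sub>1 + C\<^sub>2 + C\<^sub>3) * \<Delta> + e"
      proof (cases "real k * \<Delta> < T")
        case True
        have "0 \<le> C\<^sub>1 * \<Delta>" "0 \<le> C\<^sub>2 * \<Delta>" using C1(1) C2(1) \<Delta> by auto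
        with C3(2)[OF \<Delta> True, of x] e show ?thesis by (simp add: distrib_right)
      next
        case False
        with k have kT: "real k * \<Delta> = T" by simp
        obtain r where r: "0 < r" "\<And>x s s'. s \<in> {0..T} \<Longrightarrow> s' \<in> {0..T} \<Longrightarrow> \<bar>s - s'\<bar> < r \<Longrightarrow> \<bar>v x s - v x s'\<bar> < e"
          using periodic_continuous_time_modulus[OF v_periodic v_continuous e] by blast
        obtain m where m: "0 < m" "\<Delta> / real m < r" using fine_step[OF \<Delta> r(1)] by blast
        define \<delta> where "\<delta> = \<Delta> / real m"
        have \<delta>: "0 < \<delta>" "\<delta> \<le> \<Delta>" "\<delta> < r" using \<Delta> m by (auto simp: \<delta>_def field_simps)
        have "0 < k * m" using m kT assms by (cases k) auto
        then obtain j where j: "k * m = Suc j" by (cases "k * m") auto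
        have "real (k * m) * \<delta> = T" using kT m by (simp add: \<delta>_def)
        then have jT: "real (Suc j) * \<delta> = T" by (simp add: j)
        then have jT': "real j * \<delta> = T - \<delta>" by (simp add: algebra_simps)
        have "0 \<le> real j * \<delta>" using \<delta> by simp
        then have "\<bar>v x T - v x (real j * \<delta>)\<bar> < e"
          using r(2)[of T "real j * \<delta>" x] jT' \<delta> assms by simp
        moreover have "\<bar>Z \<delta> j x - v x (real j * \<delta>)\<bar> \<le> C\<^sub>3 * \<delta>"
          using C3(2)[OF \<delta>(1), of j x] jT' \<delta> by simp
        moreover have "\<bar>Z \<delta> (Suc j) x - Z \<delta> j x\<bar> \<le> C\<^sub>2 * \<delta>"
          using C2(2)[of \<delta> j x] jT \<delta> by simp
        moreover have "\<bar>Z \<delta> (Suc j) x - Z \<Delta> k x\<bar> \<le> C\<^sub>1 * \<Delta>"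
          using C1(2)[OF \<Delta> m(1) k, of x] by (simp add: \<delta>_def j)
        moreover have "C\<^sub>3 * \<delta> \<le> C\<^sub>3 * \<Delta>" "C\<^sub>2 * \<delta> \<le> C\<^sub>2 * \<Delta>"
          using \<delta> C2(1) C3(1) by (auto intro: mult_left_mono)
        ultimately show ?thesis unfolding kT distrib_right by linarith
      qed
    qed
  qed
qed

end

section \<open>The Legendre transform\<close>

text \<open>Superlinear growth of \<open>H0\<close> beats \<open>a \<bullet> p\<close> outside a ball, and on the ball
  continuity is enough. So the supremum of reals that defines the Legendre transform is genuine.\<close>

lemma legendre_bdd_above:
  fixes H0 :: "real^'n \<Rightarrow> real"
  assumes cont: "continuous_on UNIV H0" and sup: "filterlim (\<lambda>p. H0 p / norm p) at_top at_infinity"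
  shows "bdd_above (range (\<lambda>p. a \<bullet> p - H0 p))"
proof -
  from sup have "\<forall>\<^sub>F p in at_infinity. norm a \<le> H0 p / norm p" by (simp add: filterlim_at_top)
  then obtain b where b: "\<And>p. b \<le> norm p \<Longrightarrow> norm a \<le> H0 p / norm p"
    by (auto simp: eventually_at_infinity)
  have "compact ((\<lambda>p. a \<bullet> p - H0 p) ` cball 0 (max 1 b))"
    by (intro compact_continuous_image continuous_intros continuous_on_subset[OF cont]) auto
  then have "bdd_above ((\<lambda>p. a \<bullet> p - H0 p) ` cball 0 (max 1 b))"
    by (intro bounded_imp_bdd_above compact_imp_bounded)
  then obtain B where "\<forall>y\<in>(\<lambda>p. a \<bullet> p - H0 p) ` cball 0 (max 1 b). y \<le> B"
    unfolding bdd_above_def by blast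
  then have B: "a \<bullet> p - H0 p \<le> B" if "norm p \<le> max 1 b" for p using that by simp
  have "a \<bullet> p - H0 p \<le> max 0 B" for p
  proof (cases "norm p \<le> max 1 b")
    case True with B[of p] show ?thesis by simp
  next
    case False
    then have "norm a \<le> H0 p / norm p" "0 < norm p" using b[of p] by auto
    then have "norm a * norm p \<le> H0 p" by (simp only: pos_le_divide_eq)
    then show ?thesis using norm_cauchy_schwarz[of a p] by simp
  qed
  then show ?thesis by (auto simp: bdd_above_def)
qed

lemma convex_above_tangent_plane:
  fixes f :: "'a::real_inner \<Rightarrow> real"
  assumes conv: "convex_on UNIV f" and der: "(f has_derivative (\<lambda>h. G \<bullet> h)) (at p)"
  shows "f p + G \<bullet> (q - p) \<le> f q"
proof -
  let ?\<phi> = "\<lambda>t. f (p + t *\<^sub>R (q - p))"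
  have "convex_on UNIV ?\<phi>"
  proof (rule convex_onI)
    fix t x y :: real assume t: "0 < t" "t < 1"
    have "p + ((1 - t) *\<^sub>R x + t *\<^sub>R y) *\<^sub>R (q - p)
       = (1 - t) *\<^sub>R (p + x *\<^sub>R (q - p)) + t *\<^sub>R (p + y *\<^sub>R (q - p))"
      by (simp add: algebra_simps)
    then show "?\<phi> ((1 - t) *\<^sub>R x + t *\<^sub>R y) \<le> (1 - t) * ?\<phi> x + t * ?\<phi> y"
      using convex_onD[OF conv, of t "p + x *\<^sub>R (q - p)" "p + y *\<^sub>R (q - p)"] t by simp
  qed simp
  moreover have "(?\<phi> has_real_derivative (G \<bullet> (q - p))) (at 0)"
  proof -
    have "((\<lambda>t. p + t *\<^sub>R (q - p)) has_derivative (\<lambda>t. t *\<^sub>R (q - p))) (at (0::real))"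
      by (auto intro!: derivative_eq_intros)
    moreover have "(f has_derivative (\<lambda>h. G \<bullet> h)) (at (p + 0 *\<^sub>R (q - p)))" using der by simp
    ultimately have "(?\<phi> has_derivative (\<lambda>t. G \<bullet> (t *\<^sub>R (q - p)))) (at 0)"
      by (rule has_derivative_compose)
    moreover have "(\<lambda>t. G \<bullet> (t *\<^sub>R (q - p))) = (*) (G \<bullet> (q - p))" by (simp add: fun_eq_iff)
    ultimately show ?thesis unfolding has_field_derivative_def by simp
  qed
  ultimately have "?\<phi> 1 - ?\<phi> 0 \<ge> (G \<bullet> (q - p)) * (1 - 0)"
    by (intro convex_on_imp_above_tangent) auto
  then show ?thesis by simp
qed

context
  fixes H0 :: "real^'n \<Rightarrow> real"
  assumes C2: "C2_function H0" and conv: "convex_on UNIV H0"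
    and sup: "filterlim (\<lambda>p. H0 p / norm p) at_top at_infinity"
begin

lemma hamiltonian_continuous: "continuous_on UNIV H0"
proof -
  obtain G where "\<And>p. (H0 has_derivative (\<lambda>h. G p \<bullet> h)) (at p)"
    using C2 unfolding C2_function_def by blast
  from has_derivative_continuous[OF this] show ?thesis by (simp add: continuous_at_imp_continuous_on)
qed

lemma legendre_upper: "a \<bullet> p \<le> legendre H0 a + H0 p"
  using cSUP_upper[OF UNIV_I legendre_bdd_above[OF hamiltonian_continuous sup], of a p]
  unfolding legendre_def by linarith

lemma legendre_least: "(\<And>p. a \<bullet> p - H0 p \<le> c) \<Longrightarrow> legendre H0 a \<le> c"
  unfolding legendre_def by (intro cSUP_least) auto

lemma legendre_convex: "convex_on UNIV (legendre H0)"
proof (rule convex_onI)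
  fix t a b assume t: "0 < t" "t < (1::real)"
  show "legendre H0 ((1 - t) *\<^sub>R a + t *\<^sub>R b) \<le> (1 - t) * legendre H0 a + t * legendre H0 b"
  proof (rule legendre_least)
    fix p
    have "(1 - t) * (a \<bullet> p - H0 p) + t * (b \<bullet> p - H0 p) \<le> (1 - t) * legendre H0 a + t * legendre H0 b"
      using legendre_upper[of a p] legendre_upper[of b p] t by (intro add_mono mult_left_mono) auto
    then show "((1 - t) *\<^sub>R a + t *\<^sub>R b) \<bullet> p - H0 p \<le> (1 - t) * legendre H0 a + t * legendre H0 b"
      by (simp add: inner_add_left algebra_simps)
  qed
qed simp

text \<open>Test the supremum with \<open>p = M a / |a|\<close>.\<close>

lemma legendre_superlinear: "\<exists>C. \<forall>a. M * norm a - C \<le> legendre H0 a"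
proof -
  \<comment> \<open>for negative \<open>M\<close> the bound follows from the one for \<open>0\<close>\<close>
  define M' where "M' = max 0 M"
  have "compact (H0 ` cball 0 M')"
    by (intro compact_continuous_image continuous_on_subset[OF hamiltonian_continuous]) auto
  then have "bdd_above (H0 ` cball 0 M')"
    by (intro bounded_imp_bdd_above compact_imp_bounded)
  then obtain C where "\<forall>y\<in>H0 ` cball 0 M'. y \<le> C" unfolding bdd_above_def by blast
  then have C: "H0 p \<le> C" if "norm p \<le> M'" for p using that by simp
  have "M * norm a - C \<le> legendre H0 a" for a
  proof -
    let ?p = "(M' / norm a) *\<^sub>R a"
    have "norm ?p \<le> M'" "a \<bullet> ?p = M' * norm a"
      by (auto simp: M'_def dot_square_norm power2_eq_square)
    moreover have "M * norm a \<le> M' * norm a" by (intro mult_right_mono) (auto simp: M'_def)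
    ultimately show ?thesis using legendre_upper[of a ?p] C[of ?p] by linarith
  qed
  then show ?thesis by blast
qed

text \<open>The supremum for \<open>a = \<nabla>H0(p)\<close> is attained at \<open>p\<close>, because the convex function
  \<open>H0\<close> lies above its tangent planes; the gradient is continuous, hence bounded on balls.\<close>

lemma legendre_attained:
  "\<exists>A. \<forall>p. norm p \<le> \<rho> \<longrightarrow> (\<exists>a. norm a \<le> A \<and> legendre H0 a + H0 p \<le> a \<bullet> p)"
proof -
  obtain G :: "real^'n \<Rightarrow> real^'n" and D where
    G: "\<And>p. (H0 has_derivative (\<lambda>h. G p \<bullet> h)) (at p)" and D: "\<And>p. (G has_derivative (\<lambda>h. D p *v h)) (at p)"
    using C2 unfolding C2_function_def by blast
  have "continuous_on UNIV G"
    using has_derivative_continuous[OF D] by (simp add: continuous_at_imp_continuous_on)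
  then have "bounded (G ` cball 0 \<rho>)"
    by (intro compact_imp_bounded compact_continuous_image) (auto intro: continuous_on_subset)
  then obtain A where "\<forall>x\<in>G ` cball 0 \<rho>. norm x \<le> A" unfolding bounded_iff by blast
  then have A: "norm (G p) \<le> A" if "norm p \<le> \<rho>" for p using that by simp
  have "legendre H0 (G p) \<le> G p \<bullet> p - H0 p" for p
    using convex_above_tangent_plane[OF conv G]
    by (intro legendre_least) (simp add: inner_diff_right algebra_simps)
  then have G_att: "legendre H0 (G p) + H0 p \<le> G p \<bullet> p" for p by (simp add: le_diff_eq)
  show ?thesis
  proof (intro exI[of _ A] allI impI)
    fix p :: "real^'n" assume "norm p \<le> \<rho>"
    then show "\<exists>a. norm a \<le> A \<and> legendre H0 a + H0 p \<le> a \<bullet> p"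
      using A G_att by (intro exI[of _ "G p"] conjI)
  qed
qed

end

section \<open>From the sup norm to the Lebesgue norms\<close>

lemma semi_lagrangian_solution_eq_sl_iter:
  assumes "semi_lagrangian_solution L V g \<Delta>t N w" "n \<le> N"
  shows "w n = sl_iter L V g \<Delta>t (N - n)"
  using assms(2)
proof (induction rule: inc_induct)
  case base then show ?case using assms(1) by (simp add: semi_lagrangian_solution_def)
next
  case (step n)
  have "w n x = sl_step L V \<Delta>t (w (Suc n)) x" for x
    using assms(1) step.hyps by (simp add: semi_lagrangian_solution_def sl_step_def)
  moreover have "N - n = Suc (N - Suc n)" using step.hyps by simp
  ultimately show ?case using step.IH by (simp add: sl_iter_Suc fun_eq_iff)
qed

text \<open>The unit cell has measure \<open>1\<close>.\<close>

lemma torus_Lp_norm_le_bound: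
  fixes f :: "real^'n \<Rightarrow> real"
  assumes cont: "continuous_on UNIV f" and le: "\<And>x. \<bar>f x\<bar> \<le> c" and p: "1 \<le> p"
  shows "torus_Lp_norm p f \<le> ennreal c"
proof -
  have c: "0 \<le> c" using le[of 0] by simp
  have meas: "f \<in> borel_measurable torus_measure"
    unfolding torus_measure_def
    by (rule measurable_restrict_space1) (use borel_measurable_continuous_onI[OF cont] in simp)
  have space: "emeasure torus_measure (space (torus_measure :: (real^'n) measure)) = 1"
  proof -
    have "(1 :: real^'n) \<bullet> b = 1" if "b \<in> Basis" for b
      using that by (auto simp: Basis_vec_def inner_axis)
    then have "emeasure lborel (cbox 0 (1 :: real^'n)) = 1"
      by (subst emeasure_lborel_cbox) auto
    then show ?thesis
      by (simp add: torus_measure_def space_restrict_space emeasure_restrict_space)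
  qed
  show ?thesis
  proof (cases "p = \<infinity>")
    case True
    have "esssup torus_measure (\<lambda>x. ennreal \<bar>f x\<bar>) \<le> ennreal c"
      by (rule esssup_I) (use meas le in \<open>auto intro!: ennreal_leI\<close>)
    then show ?thesis using True by (simp add: torus_Lp_norm_def)
  next
    case False
    define r where "r = enn2real p"
    have r: "1 \<le> r"
      using p False enn2real_mono[of 1 p] by (simp add: r_def top.not_eq_extremum)
    define I where "I = (\<integral>\<^sup>+x. ennreal (\<bar>f x\<bar> powr r) \<partial>torus_measure)"
    have "I \<le> (\<integral>\<^sup>+x. ennreal (c powr r) \<partial>(torus_measure :: (real^'n) measure))"
      unfolding I_def using le r by (intro nn_integral_mono ennreal_leI powr_mono2) auto
    also have "\<dots> = ennreal (c powr r)" by (simp add: space)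
    finally have I: "I \<le> ennreal (c powr r)" .
    then have "I \<noteq> \<infinity>" by (auto simp: top_unique)
    moreover have "enn2real I powr (1 / r) \<le> c"
    proof -
      have "enn2real I \<le> c powr r" using I by (intro enn2real_leI) auto
      then have "enn2real I powr (1 / r) \<le> (c powr r) powr (1 / r)" using r by (intro powr_mono2) auto
      also have "\<dots> = c" using r c by (simp add: powr_powr)
      finally show ?thesis .
    qed
    ultimately show ?thesis
      using False meas by (simp add: torus_Lp_norm_def r_def[symmetric] I_def[symmetric] ennreal_leI)
  qed
qed

text \<open>A step never exceeds the horizon \<open>T\<close>, so lower powers of it are larger up to a constant.\<close>

lemma linear_rate_implies_powr_rate:
  fixes t \<theta> T :: real
  assumes "0 < t" "t \<le> T" "0 \<le> \<theta>" "\<theta> \<le> 1"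
  shows "t \<le> max 1 T * t powr \<theta>"
proof -
  have "t powr (1 - \<theta>) \<le> max 1 T powr (1 - \<theta>)" using assms by (intro powr_mono2) auto
  also have "\<dots> \<le> max 1 T powr 1" using assms by (intro powr_mono) auto
  finally have "t powr (1 - \<theta>) * t powr \<theta> \<le> max 1 T * t powr \<theta>"
    by (intro mult_right_mono) auto
  then show ?thesis using assms by (simp add: powr_add[symmetric])
qed

lemma conjugate_exponent_bound:
  assumes "(1::ennreal) \<le> p"
  shows "enn2real (1 / (2 * p)) \<le> 1 / 2"
proof (cases p)
  case (real r)
  then have r: "1 \<le> r" using assms by simp
  have "(2::ennreal) * ennreal r = ennreal (2 * r)" using r by (subst ennreal_mult) auto
  then have "1 / (2 * p) = ennreal (1 / (2 * r))"
    using r real divide_ennreal[of 1 "2 * r"] by simp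
  then show ?thesis using r by simp
next
  case top then show ?thesis by (simp add: ennreal_mult_top)
qed

theorem corollary3p6:
  fixes H0 V g :: "real^'n \<Rightarrow> real" and u :: "real^'n \<Rightarrow> real \<Rightarrow> real" and T :: real
  assumes "T > 0"
    and "C2_function H0" and "convex_on UNIV H0"
    and "filterlim H0 at_top at_infinity"
    and "filterlim (\<lambda>p. H0 p / norm p) at_top at_infinity"
    and "torus_periodic V" and "\<exists>K. K-lipschitz_on UNIV V" and "semiconcave V"
    and "torus_periodic g" and "\<exists>K. K-lipschitz_on UNIV g" and "semiconcave g"
    and "viscosity_solution_backward (\<lambda>x p. H0 p - V x) T g u"
  shows "\<forall>p::ennreal. p \<ge> 1 \<longrightarrow>
    (\<exists>C::real. C > 0 \<and>
      (\<forall>\<Delta>t (N::nat) w. \<Delta>t > 0 \<and> N > 0 \<and> real N = T / \<Delta>t \<and>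
         semi_lagrangian_solution (legendre H0) V g \<Delta>t N w \<longrightarrow>
         (SUP n\<in>{0..N}. torus_Lp_norm p (\<lambda>x. w n x - u x (real n * \<Delta>t)))
           \<le> ennreal (C * \<Delta>t powr (1 / 2 + enn2real (1 / (2 * p))))))"
proof (intro allI impI)
  fix p :: ennreal assume p: "1 \<le> p"
  obtain KV Kg where KV: "KV-lipschitz_on UNIV V" and Kg: "Kg-lipschitz_on UNIV g"
    using assms(7,10) by blast
  define v where "v x s = u x (T - s)" for x s
  interpret hj_problem "legendre H0" V g KV Kg T H0 v
  proof
    show "viscosity_solution_forward (\<lambda>x p. H0 p - V x) T g v"
      using assms(12) by (simp add: viscosity_solution_backward_def v_def[abs_def])
  qed (fact legendre_convex[OF assms(2,3,5)] legendre_superlinear[OF assms(2,3,5)]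
      legendre_upper[OF assms(2,3,5)] legendre_attained[OF assms(2,3,5)] KV Kg
      less_imp_le[OF assms(1)] assms)+
  obtain C where C: "0 \<le> C"
    "\<And>\<Delta> k x. 0 < \<Delta> \<Longrightarrow> real k * \<Delta> \<le> T \<Longrightarrow> \<bar>Z \<Delta> k x - v x (real k * \<Delta>)\<bar> \<le> C * \<Delta>"
    using scheme_error[OF assms(1)] by blast
  define \<theta> where "\<theta> = 1 / 2 + enn2real (1 / (2 * p))"
  have \<theta>: "0 \<le> \<theta>" "\<theta> \<le> 1" using conjugate_exponent_bound[OF p] by (auto simp: \<theta>_def)
  show "\<exists>C>0. \<forall>\<Delta>t (N::nat) w. \<Delta>t > 0 \<and> N > 0 \<and> real N = T / \<Delta>t \<and>
         semi_lagrangian_solution (legendre H0) V g \<Delta>t N w \<longrightarrow>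
         (SUP n\<in>{0..N}. torus_Lp_norm p (\<lambda>x. w n x - u x (real n * \<Delta>t)))
           \<le> ennreal (C * \<Delta>t powr (1 / 2 + enn2real (1 / (2 * p))))"
    unfolding \<theta>_def[symmetric]
  proof (intro exI[of _ "(C + 1) * max 1 T"] conjI allI impI SUP_least)
    show "0 < (C + 1) * max 1 T" using C(1) by simp
    fix \<Delta>t and N n :: nat and w
    assume A: "\<Delta>t > 0 \<and> N > 0 \<and> real N = T / \<Delta>t \<and> semi_lagrangian_solution (legendre H0) V g \<Delta>t N w"
      and "n \<in> {0..N}"
    then have n: "n \<le> N" and \<Delta>t: "0 < \<Delta>t" and NT: "real N * \<Delta>t = T" by auto
    have kT: "real (N - n) * \<Delta>t = T - real n * \<Delta>t"
      using n NT by (simp add: of_nat_diff left_diff_distrib)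
    have k: "real (N - n) * \<Delta>t \<le> T" unfolding kT using \<Delta>t by simp
    have k0: "0 \<le> real (N - n) * \<Delta>t" using \<Delta>t by simp
    have w: "w n = Z \<Delta>t (N - n)" by (rule semi_lagrangian_solution_eq_sl_iter) (use A n in auto)
    have u: "u x (real n * \<Delta>t) = v x (real (N - n) * \<Delta>t)" for x by (simp add: v_def kT)
    have "0 < N" using A by blast
    then have "1 \<le> real N" by simp
    from mult_right_mono[OF this less_imp_le[OF \<Delta>t]] have "\<Delta>t \<le> T" unfolding NT by simp
    define s where "s = real (N - n) * \<Delta>t"
    have s: "s \<in> {0..T}" using k k0 by (simp add: s_def)
    have "continuous_on UNIV (\<lambda>x. (\<lambda>(x, s). v x s) (x, s))"
      by (rule continuous_on_compose2[OF v_continuous])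
         (use s in \<open>auto intro!: continuous_on_Pair continuous_on_id continuous_on_const\<close>)
    then have "continuous_on UNIV (\<lambda>x. v x (real (N - n) * \<Delta>t))" by (simp add: s_def)
    moreover have "continuous_on UNIV (Z \<Delta>t (N - n))"
      using Z_lipschitz[OF less_imp_le[OF \<Delta>t] k] by (rule lipschitz_on_continuous_on)
    ultimately have cont: "continuous_on UNIV (\<lambda>x. w n x - u x (real n * \<Delta>t))"
      unfolding w u by (intro continuous_intros)
    have "torus_Lp_norm p (\<lambda>x. w n x - u x (real n * \<Delta>t)) \<le> ennreal (C * \<Delta>t)"
      by (rule torus_Lp_norm_le_bound[OF cont _ p]) (use C(2)[OF \<Delta>t k] in \<open>simp add: w u\<close>)
    also have "\<dots> \<le> ennreal ((C + 1) * max 1 T * \<Delta>t powr \<theta>)"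
    proof (rule ennreal_leI)
      have "C * \<Delta>t \<le> (C + 1) * \<Delta>t" using \<Delta>t by (intro mult_right_mono) auto
      also have "\<dots> \<le> (C + 1) * (max 1 T * \<Delta>t powr \<theta>)"
        using linear_rate_implies_powr_rate[OF \<Delta>t \<open>\<Delta>t \<le> T\<close> \<theta>] C(1) by (intro mult_left_mono) auto
      finally show "C * \<Delta>t \<le> (C + 1) * max 1 T * \<Delta>t powr \<theta>" by (simp add: mult.assoc)
    qed
    finally show "torus_Lp_norm p (\<lambda>x. w n x - u x (real n * \<Delta>t)) \<le> ennreal ((C + 1) * max 1 T * \<Delta>t powr \<theta>)" .
  qed
qed

end
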